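(* Let $H=\sum_{J\in S}H_J$ be a site-local Hamiltonian on a lattice with $\mathsf N_\Lambda=\mathcal O(1)$ sites (so $\mathsf N_H=\mathcal O(1)$) with parameters $\mathsf N_P,\mathsf c_P$, and let $t>0$, $\varepsilon>0$. Then there exists a quantum circuit which is a $(1\pm\mathcal O(\varepsilon),\mathcal O(\log\mathsf N_P))$-block-encoding of an operator $A$ with $\|A-e^{-iHt}\|\le\varepsilon$, and whose elementary gate count is $$\chi=\mathcal O\!\Big[\mathsf N_P\log\mathsf N_P\big(\mathsf N_P\mathsf c_P t+\log(1/\varepsilon)\big)\Big].$$
   Context: A $\mathsf k$-site-local Hamiltonian on a finite lattice $\Lambda$ ($\mathsf N_\Lambda=|\Lambda|$, each site carrying $\mathsf n_q$ qubits) is $H=\sum_{J\in S}H_J$, with $S$ a set of subsets of at most $\mathsf k$ sites, each $H_J$ Hermitian acting only on the qubits of the sites in $J$; $\mathsf N_H=|S|$. Each $H_J=\sum_{i=1}^{\mathsf N_P^{(J)}}c_i^{(J)}P_i^{(J)}$ (distinct Pauli strings, nonzero coefficients); $\mathsf N_P=\max_J\mathsf N_P^{(J)}$, $\mathsf c_P=\max_{J,i}|c_i^{(J)}|$. For $\alpha>0$ and integer $k\ge0$, a unitary $U$ on $\mathcal H_a\otimes\mathcal H_s$ ($\mathcal H_a$ the space of $k$ ancilla qubits) is an $(\alpha,k)$-block-encoding of an operator $A$ on $\mathcal H_s$ if there is a state $|g\rangle_a$ with $(\langle g|_a\otimes I_s)U(|g\rangle_a\otimes I_s)=A/\alpha$.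 Cost model: elementary gates from a fixed universal set; a (controlled) Pauli string is counted as a constant number of gates and a gate controlled on $m$ qubits costs $\mathcal O(m)$ gates.
   Formalization: The error is restricted to 0 < ε < 1 (for large ε the bracket with log(1/ε) is negative) and log N_P is replaced by log(N_P+1) (for N_P = 1 the stated bound would allow no gates); arbitrary single-qubit unitaries count as elementary gates. *)

theory Defs
  imports Complex_Main
begin

type_synonym cmat = "nat \<Rightarrow> nat \<Rightarrow> complex"

definition mmul :: "nat \<Rightarrow> cmat \<Rightarrow> cmat \<Rightarrow> cmat" where
  "mmul d A B = (\<lambda>i j. \<Sum>l<d. A i l * B l j)"

definition mid :: cmat where
  "mid = (\<lambda>i j. if i = j then 1 else 0)"

fun mpow :: "nat \<Rightarrow> cmat \<Rightarrow> nat \<Rightarrow> cmat" where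
  "mpow d A 0 = mid"
| "mpow d A (Suc n) = mmul d A (mpow d A n)"

definition mexp :: "nat \<Rightarrow> cmat \<Rightarrow> cmat" where
  "mexp d A = (\<lambda>i j. \<Sum>n. mpow d A n i j / of_nat (fact n))"

definition vnorm :: "nat \<Rightarrow> (nat \<Rightarrow> complex) \<Rightarrow> real" where
  "vnorm d v = sqrt (\<Sum>i<d. (cmod (v i))\<^sup>2)"

definition op_norm :: "nat \<Rightarrow> cmat \<Rightarrow> real" where
  "op_norm d A = Sup {vnorm d (\<lambda>i. \<Sum>j<d. A i j * v j) | v. vnorm d v = 1}"

definition unitary2 :: "cmat \<Rightarrow> bool" where
  "unitary2 U = (\<forall>i<2. \<forall>j<2. (\<Sum>l<2. cnj (U l i) * U l j) = mid i j)"

text \<open>Basis index r of an N-qubit register; qubit j is bit j of r.\<close>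
definition bitn :: "nat \<Rightarrow> nat \<Rightarrow> nat" where
  "bitn r j = (r div 2 ^ j) mod 2"

datatype pauli = PI | PX | PY | PZ

fun pauli_mat :: "pauli \<Rightarrow> cmat" where
  "pauli_mat PI = (\<lambda>i j. if i = j then 1 else 0)"
| "pauli_mat PX = (\<lambda>i j. if i \<noteq> j then 1 else 0)"
| "pauli_mat PY = (\<lambda>i j. if i = 0 \<and> j = 1 then - \<i> else if i = 1 \<and> j = 0 then \<i> else 0)"
| "pauli_mat PZ = (\<lambda>i j. if i = j then (if i = 0 then 1 else -1) else 0)"

type_synonym pstring = "nat \<Rightarrow> pauli"

definition pstr_supp :: "pstring \<Rightarrow> nat set" where
  "pstr_supp P = {j. P j \<noteq> PI}"

definition pstr_mat :: "nat \<Rightarrow> pstring \<Rightarrow> cmat" where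
  "pstr_mat N P = (\<lambda>r c. \<Prod>j<N. pauli_mat (P j) (bitn r j) (bitn c j))"

text \<open>Sites 0..N_Lambda-1, site s carries qubits s*nq .. s*nq+nq-1.
  The Hamiltonian is given by the set S of site subsets and, for each J in S,
  the real coefficient function of H_J on Pauli strings (real coefficients = Hermitian);
  the terms of H_J are the Pauli strings with nonzero coefficient.\<close>

definition qubits_of :: "nat \<Rightarrow> nat set \<Rightarrow> nat set" where
  "qubits_of nq J = {q. nq > 0 \<and> q div nq \<in> J}"

definition terms :: "(nat set \<Rightarrow> pstring \<Rightarrow> real) \<Rightarrow> nat set \<Rightarrow> pstring set" where
  "terms coef J = {P. coef J P \<noteq> 0}"

definition site_local_ham ::
  "nat \<Rightarrow> nat \<Rightarrow> nat set set \<Rightarrow> (nat set \<Rightarrow> pstring \<Rightarrow> real) \<Rightarrow> bool" where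
  "site_local_ham NL nq S coef \<longleftrightarrow> finite S \<and>
     (\<forall>J\<in>S. J \<subseteq> {..<NL} \<and> finite (terms coef J) \<and>
        (\<forall>P\<in>terms coef J. pstr_supp P \<subseteq> qubits_of nq J))"

definition ham_mat :: "nat \<Rightarrow> nat \<Rightarrow> nat set set \<Rightarrow> (nat set \<Rightarrow> pstring \<Rightarrow> real) \<Rightarrow> cmat" where
  "ham_mat NL nq S coef = (\<lambda>r c. \<Sum>J\<in>S. \<Sum>P\<in>terms coef J.
      complex_of_real (coef J P) * pstr_mat (NL * nq) P r c)"

definition NP :: "nat set set \<Rightarrow> (nat set \<Rightarrow> pstring \<Rightarrow> real) \<Rightarrow> nat" where
  "NP S coef = Max (insert 0 ((\<lambda>J. card (terms coef J)) ` S))"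

definition cP :: "nat set set \<Rightarrow> (nat set \<Rightarrow> pstring \<Rightarrow> real) \<Rightarrow> real" where
  "cP S coef = Max (insert 0 {\<bar>coef J P\<bar> | J P. J \<in> S \<and> P \<in> terms coef J})"

text \<open>Elementary operations: an arbitrary single-qubit unitary, or a Pauli string;
  each possibly controlled on a list of qubits (qubit, required value).
  Cost: 1 + number of controls (uncontrolled single-qubit gates and Pauli strings
  cost O(1), a gate controlled on m qubits costs O(m)).\<close>

datatype base_gate = U1 nat cmat | PStr pstring

type_synonym gate = "(nat \<times> bool) list \<times> base_gate"

fun base_supp :: "base_gate \<Rightarrow> nat set" where
  "base_supp (U1 q U) = {q}"
| "base_supp (PStr P) = pstr_supp P"

fun base_entry :: "nat \<Rightarrow> base_gate \<Rightarrow> cmat" where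
  "base_entry N (U1 q U) = (\<lambda>r c. if (\<forall>j<N. j \<noteq> q \<longrightarrow> bitn r j = bitn c j)
                                   then U (bitn r q) (bitn c q) else 0)"
| "base_entry N (PStr P) = pstr_mat N P"

fun base_ok :: "base_gate \<Rightarrow> bool" where
  "base_ok (U1 q U) = unitary2 U"
| "base_ok (PStr P) = True"

definition gate_ok :: "nat \<Rightarrow> gate \<Rightarrow> bool" where
  "gate_ok N g \<longleftrightarrow> distinct (map fst (fst g)) \<and> set (map fst (fst g)) \<subseteq> {..<N} \<and>
     base_supp (snd g) \<subseteq> {..<N} \<and> base_supp (snd g) \<inter> set (map fst (fst g)) = {} \<and>
     base_ok (snd g)"

definition gate_mat :: "nat \<Rightarrow> gate \<Rightarrow> cmat" where
  "gate_mat N g = (\<lambda>r c. if (\<forall>(q, v)\<in>set (fst g). (bitn c q = 1) = v)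
                        then base_entry N (snd g) r c
                        else (if r = c then 1 else 0))"

definition gate_cost :: "gate \<Rightarrow> nat" where
  "gate_cost g = 1 + length (fst g)"

text \<open>Circuit = list of gates, the head applied first.\<close>
fun circuit_mat :: "nat \<Rightarrow> gate list \<Rightarrow> cmat" where
  "circuit_mat N [] = mid"
| "circuit_mat N (g # gs) = mmul (2 ^ N) (circuit_mat N gs) (gate_mat N g)"

definition circuit_cost :: "gate list \<Rightarrow> nat" where
  "circuit_cost gs = (\<Sum>g\<leftarrow>gs. gate_cost g)"

text \<open>U acts on k ancilla qubits (the high qubits m..m+k-1) tensor m system qubits
  (qubits 0..m-1); basis index a * 2^m + s.  U is an (alpha,k)-block-encoding of A
  if (<g| x I) U (|g> x I) = A / alpha for some normalized ancilla state g.\<close>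
definition block_encoding :: "nat \<Rightarrow> nat \<Rightarrow> cmat \<Rightarrow> real \<Rightarrow> cmat \<Rightarrow> bool" where
  "block_encoding m k U \<alpha> A \<longleftrightarrow> \<alpha> > 0 \<and>
     (\<exists>g. vnorm (2 ^ k) g = 1 \<and>
        (\<forall>s<2 ^ m. \<forall>s'<2 ^ m.
           (\<Sum>a<2 ^ k. \<Sum>a'<2 ^ k. cnj (g a) * U (a * 2 ^ m + s) (a' * 2 ^ m + s') * g a')
           = A s s' / complex_of_real \<alpha>))"

end

theory Submission
  imports Defs "HOL-Analysis.Analysis" "HOL-Computational_Algebra.Fundamental_Theorem_Algebra"
begin

text \<open>Qubitization with generalised quantum signal processing. Write \<open>H\<close> as a multiple \<open>c X\<close> of
  an average \<open>X\<close> of at most \<open>2\<^sup>a\<close> Pauli strings with coefficients in \<open>[-1,1]\<close>. A uniform index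
  register and one extra qubit give a self-inverse \<open>V\<close> with \<open>\<langle>G|V|G\<rangle> = X\<close>, and with the reflection
  \<open>R\<close> about \<open>G\<close> the walk \<open>W = R V\<close> satisfies \<open>(W + W\<^sup>-\<^sup>1) / 2 G = G X\<close>. Hence the Laurent
  polynomial \<open>p((z + 1/z) / 2)\<close>, with \<open>p\<close> the degree \<open>K\<close> Taylor polynomial of \<open>exp(- i \<tau> x)\<close> and
  \<open>\<tau> = c t\<close>, evaluated at \<open>W\<close> encodes \<open>p(X)\<close>, and \<open>K = O(\<tau> + ln(1/\<epsilon>))\<close> makes the error at most
  \<open>\<epsilon>\<close>. After division by \<open>1 + 2 \<epsilon>\<close> the polynomial has modulus below one on the unit circle, so the
  Fejer-Riesz theorem supplies a complementary polynomial and the pair factors into single-qubit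
  rotations interleaved with controlled applications of \<open>W\<close>. When the target cost is
  too small to allow any gate, the identity is already \<open>\<epsilon>\<close>-close to the evolution.\<close>

section \<open>Polynomials on the unit circle\<close>

text \<open>The sizes and signs of the coefficients sit in the extra qubit and not in a state
  preparation: a real reflection with the coefficient as its top-left entry supplies it, so the
  index state stays uniform and needs only Hadamards. The price is the normalisation
  \<open>2 ^ a * cP\<close> in place of the sum of the absolute coefficients, which the target cost
  permits. No spectral decomposition of the walk is used. The single relation W^2 + 1 = 2 W X, valid
  on vectors built over the uniform index state, converts polynomials in W into polynomials in X. An
  interleaved circuit produces nonnegative powers of W only, so the Laurent polynomial is first
  multiplied by z^K, and K inverse walks at the end of the circuit remove this factor. The truncated
  exponential is bounded by 1 + \<epsilon>, not by 1. The larger divisor 1 + 2 \<epsilon> makes 1 -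
  |P|^2 strictly positive on the circle, so Fejer-Riesz never meets a zero on the circle and needs
  no argument about multiplicities.\<close>

definition crev :: "nat \<Rightarrow> complex poly \<Rightarrow> complex poly" where
  "crev n p = (\<Sum>i\<le>n. monom (cnj (coeff p (n - i))) i)"

lemma coeff_crev: "coeff (crev n p) i = (if i \<le> n then cnj (coeff p (n - i)) else 0)"
  by (simp add: crev_def coeff_sum if_distrib cong: if_cong)

lemma poly_crev:
  assumes "degree p \<le> n" "z \<noteq> 0"
  shows "poly (crev n p) z = z ^ n * cnj (poly p (1 / cnj z))"
proof -
  have "poly p x = (\<Sum>i\<le>n. coeff p i * x ^ i)" for x
  proof -
    have "poly p x = (\<Sum>i\<le>degree p. coeff p i * x ^ i)" by (rule poly_altdef)
    also have "\<dots> = (\<Sum>i\<le>n. coeff p i * x ^ i)"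
      by (rule sum.mono_neutral_left) (use assms le_degree in auto)
    finally show ?thesis .
  qed
  then have "z ^ n * cnj (poly p (1 / cnj z)) = (\<Sum>i\<le>n. cnj (coeff p i) * (z ^ n / z ^ i))"
    by (simp add: sum_distrib_left power_one_over field_simps)
  also have "\<dots> = (\<Sum>i\<le>n. cnj (coeff p i) * z ^ (n - i))"
    by (intro sum.cong refl) (use assms in \<open>simp add: power_diff\<close>)
  also have "\<dots> = (\<Sum>i\<le>n. cnj (coeff p (n - i)) * z ^ i)"
    by (rule sum.reindex_bij_witness[of _ "\<lambda>i. n - i" "\<lambda>i. n - i"]) auto
  finally show ?thesis by (simp add: crev_def poly_sum poly_monom)
qed

lemma inverse_cnj_unit: "cmod z = 1 \<Longrightarrow> 1 / cnj z = z"
  by (metis complex_div_cnj complex_mod_cnj div_by_1 divide_complex_def inverse_eq_divide complex_cnj_cnj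
      mult_1 of_real_1 power_one complex_cnj_one)

text \<open>On the circle \<open>crev\<close> makes conjugation polynomial:
  \<open>p * crev n p\<close> takes the values z^n |p(z)|^2, so identities between squared moduli
  become identities of polynomials. The nominal degree n may exceed the degree of p, which keeps the
  inductions below uniform.\<close>

lemma poly_crev_unit:
  assumes "degree p \<le> n" "cmod z = 1"
  shows "poly (crev n p) z = z ^ n * cnj (poly p z)"
  using poly_crev[OF assms(1), of z] assms inverse_cnj_unit[of z] by fastforce

lemma infinite_unit_circle: "infinite {z. cmod z = 1}"
proof
  assume "finite {z. cmod z = 1}"
  moreover have "cis ` {0..1} \<subseteq> {z. cmod z = 1}" by auto
  ultimately have "finite (cis ` {0..1})" by (rule finite_subset[rotated])
  moreover have "inj_on cis {0..1}"
  proof (rule inj_onI)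
    fix x y :: real assume "x \<in> {0..1}" "y \<in> {0..1}" "cis x = cis y"
    then have "cos x = cos y" "0 \<le> x" "x \<le> pi" "0 \<le> y" "y \<le> pi"
      using pi_gt3 by (auto simp: complex_eq_iff)
    then show "x = y" using cos_inj_pi by blast
  qed
  ultimately show False using finite_imageD infinite_Icc[of 0 "1::real"] by fastforce
qed

lemma poly_eq_on_circle:
  fixes p q :: "complex poly"
  assumes "\<And>z. cmod z = 1 \<Longrightarrow> poly p z = poly q z"
  shows "p = q"
proof (rule ccontr)
  assume "p \<noteq> q"
  then have "finite {z. poly (p - q) z = 0}" by (intro poly_roots_finite) simp
  moreover have "{z. cmod z = 1} \<subseteq> {z. poly (p - q) z = 0}" using assms by auto
  ultimately show False using infinite_unit_circle finite_subset by blast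
qed

lemma degree_pCons_0_le:
  assumes "degree (pCons 0 p) \<le> Suc n" shows "degree p \<le> n"
  using assms by (cases "p = 0") auto

text \<open>Zeros are removed in pairs. Positivity makes p equal to its conjugate reciprocal, so a
  zero w comes with 1 / cnj w; strictness keeps w off the circle, so the two differ and divide out
  together. A zero at the origin has its partner at infinity: the leading coefficient vanishes as
  well, and dividing by z lowers the degree bound by two.\<close>

theorem fejer_riesz:
  fixes p :: "complex poly"
  assumes "degree p \<le> 2 * n"
    and "\<And>z. cmod z = 1 \<Longrightarrow> \<exists>r>0. poly p z = complex_of_real r * z ^ n"
  shows "\<exists>q. degree q \<le> n \<and>
    (\<forall>z. cmod z = 1 \<longrightarrow> poly p z = complex_of_real ((cmod (poly q z))\<^sup>2) * z ^ n)"
  using assms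
proof (induction n arbitrary: p)
  case 0
  obtain r where r: "r > 0" "poly p 1 = complex_of_real r" using "0.prems"(2)[of 1] by auto
  obtain c where c: "p = [:c:]" using "0.prems"(1) degree_0_id by (metis le_zero_eq mult_0_right)
  show ?case
    by (rule exI[of _ "[:complex_of_real (sqrt r):]"]) (use r c in auto)
next
  case (Suc n)
  define N where "N = Suc n"
  have self: "crev (2 * N) p = p"
  proof (rule poly_eq_on_circle)
    fix z :: complex assume z: "cmod z = 1"
    then obtain r where r: "poly p z = complex_of_real r * z ^ N"
      using Suc.prems(2) N_def by blast
    have "cnj z * z = 1" using z complex_norm_square[of z] by (simp add: mult.commute)
    then have e: "cnj z ^ N * z ^ N = 1" by (metis power_mult_distrib power_one)
    have "poly (crev (2 * N) p) z = z ^ (2 * N) * cnj (poly p z)"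
      by (rule poly_crev_unit) (use Suc.prems(1) z N_def in auto)
    also have "\<dots> = complex_of_real r * z ^ N * (cnj z ^ N * z ^ N)"
      unfolding r by (simp add: mult_2 power_add)
    finally show "poly (crev (2 * N) p) z = poly p z" using r e by simp
  qed
  have coeffs: "coeff p 0 = cnj (coeff p (2 * N))"
    using self coeff_crev[of "2 * N" p 0] by simp
  have pnz: "p \<noteq> 0" using Suc.prems(2)[of 1] by auto
  have "\<not> constant (poly p)"
  proof
    assume "constant (poly p)"
    then have "degree p = 0" by (simp add: constant_degree)
    then have "coeff p 0 = 0" using coeffs coeff_eq_0[of p "2 * N"] N_def by simp
    then show False using pnz \<open>degree p = 0\<close> by (metis leading_coeff_0_iff)
  qed
  then obtain w where w: "poly p w = 0" using fundamental_theorem_of_algebra by blast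
  show ?case
  proof (cases "w = 0")
    case True
    then have c0: "coeff p 0 = 0" using w by (simp add: poly_0_coeff_0)
    then obtain p1 where p1: "p = pCons 0 p1" by (metis pCons_cases coeff_pCons_0)
    have "degree p \<noteq> 2 * N" using coeffs c0 pnz by (metis complex_cnj_zero_iff leading_coeff_0_iff)
    then have "degree p \<le> Suc (2 * n)" using Suc.prems(1) unfolding N_def by presburger
    then have "degree (pCons 0 p1) \<le> Suc (2 * n)" unfolding p1 .
    then have "degree p1 \<le> 2 * n" by (rule degree_pCons_0_le)
    moreover have "\<exists>r>0. poly p1 z = complex_of_real r * z ^ n" if z: "cmod z = 1" for z
    proof -
      have "z \<noteq> 0" using z by auto
      then show ?thesis using Suc.prems(2)[OF z] by (auto simp: p1)
    qed
    ultimately obtain q where q: "degree q \<le> n"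
      "\<And>z. cmod z = 1 \<Longrightarrow> poly p1 z = complex_of_real ((cmod (poly q z))\<^sup>2) * z ^ n"
      using Suc.IH by blast
    show ?thesis by (rule exI[of _ q]) (use q in \<open>auto simp: p1\<close>)
  next
    case False
    define v where "v = 1 / cnj w"
    have w1: "cmod w \<noteq> 1" using Suc.prems(2)[of w] w False by auto
    have vw: "v \<noteq> w"
    proof
      assume "v = w"
      then have "w * cnj w = 1" using False by (simp add: v_def field_simps)
      then have "(cmod w)\<^sup>2 = 1" by (metis complex_norm_square of_real_eq_1_iff)
      then show False using w1 by (simp add: power2_eq_1_iff) (use norm_ge_zero[of w] in linarith)
    qed
    have "v \<noteq> 0" using False v_def by auto
    have "poly p v = v ^ (2 * N) * cnj (poly p (1 / cnj v))"
      using poly_crev[of p "2 * N" v] Suc.prems(1) N_def self \<open>v \<noteq> 0\<close> by simp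
    then have pv: "poly p v = 0" using w by (simp add: v_def)
    obtain p' where p': "p = [:-w, 1:] * p'" using w poly_eq_0_iff_dvd by (metis dvdE)
    then have "poly p' v = 0" using pv vw by simp
    then obtain p2 where p2: "p' = [:-v, 1:] * p2" using poly_eq_0_iff_dvd by (metis dvdE)
    have pp: "p = [:-w, 1:] * ([:-v, 1:] * p2)" using p' p2 by simp
    have "p2 \<noteq> 0" using pp pnz by auto
    then have "degree p = 2 + degree p2" unfolding pp
      by (simp add: degree_mult_eq del: mult_pCons_left mult_pCons_right)
    then have d: "degree (smult (-v) p2) \<le> 2 * n" using Suc.prems(1) by auto
    \<comment> \<open>From z * cnj z = 1 follows z - v = - v z (cnj z - cnj w), hence (z - w)(z - v)
      = - v z |z - w|^2. This is why the constant - v moves into the remaining factor.\<close>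
    have circ: "poly p z = complex_of_real ((cmod (z - w))\<^sup>2) * (z * poly (smult (-v) p2) z)"
      if z: "cmod z = 1" for z
    proof -
      have zz: "z * cnj z = 1" using z complex_norm_square[of z] by simp
      have vv: "v * cnj w = 1" using False by (simp add: v_def)
      have e: "complex_of_real ((cmod (z - w))\<^sup>2) = (z - w) * (cnj z - cnj w)"
        by (simp only: complex_norm_square complex_cnj_diff)
      have "complex_of_real ((cmod (z - w))\<^sup>2) * (z * poly (smult (-v) p2) z)
          = - (z - w) * poly p2 z * (v * (z * cnj z) - z * (v * cnj w))"
        unfolding e by (simp add: algebra_simps)
      also have "\<dots> = poly p z" unfolding zz vv pp by (simp add: algebra_simps)
      finally show ?thesis by simp
    qed
    have "\<exists>r>0. poly (smult (-v) p2) z = complex_of_real r * z ^ n" if z: "cmod z = 1" for z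
    proof -
      obtain r where r: "r > 0" "poly p z = complex_of_real r * z ^ Suc n"
        using Suc.prems(2)[OF z] by blast
      define s where "s = (cmod (z - w))\<^sup>2"
      have s: "s > 0" using z w1 by (auto simp: s_def)
      have "z \<noteq> 0" using z by auto
      have "z * (complex_of_real s * poly (smult (-v) p2) z) = z * (complex_of_real r * z ^ n)"
        using circ[OF z] r by (simp add: s_def mult.left_commute)
      then have "complex_of_real s * poly (smult (-v) p2) z = complex_of_real r * z ^ n"
        using \<open>z \<noteq> 0\<close> mult_left_cancel by blast
      then have "poly (smult (-v) p2) z = complex_of_real (r / s) * z ^ n"
        using s by (simp add: field_simps)
      then show ?thesis using r s by (intro exI[of _ "r / s"]) auto
    qed
    then obtain q where q: "degree q \<le> n" "\<And>z. cmod z = 1 \<Longrightarrow>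
        poly (smult (-v) p2) z = complex_of_real ((cmod (poly q z))\<^sup>2) * z ^ n"
      using Suc.IH[OF d] by blast
    show ?thesis
    proof (intro exI[of _ "[:-w, 1:] * q"] conjI allI impI)
      show "degree ([:- w, 1:] * q) \<le> Suc n"
        using q(1) degree_mult_le[of "[:-w, 1:]" q] by simp
      fix z :: complex assume z: "cmod z = 1"
      show "poly p z = complex_of_real ((cmod (poly ([:- w, 1:] * q) z))\<^sup>2) * z ^ Suc n"
      proof -
        have "poly ([:- w, 1:] * q) z = (z - w) * poly q z" by (simp add: algebra_simps)
        then show ?thesis unfolding circ[OF z] q(2)[OF z]
          by (simp only: norm_mult power_mult_distrib of_real_mult power_Suc mult_ac)
      qed
    qed
  qed
qed

text \<open>For \<open>Rs = [R\<^sub>d, \<dots>, R\<^sub>0]\<close> this is the first column of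
  \<open>R\<^sub>d diag(z,1) \<dots> diag(z,1) R\<^sub>0\<close> as a pair of polynomials in \<open>z\<close>.\<close>

fun gqsp :: "cmat list \<Rightarrow> complex poly \<times> complex poly" where
  "gqsp [] = (1, 0)"
| "gqsp (R # Rs) = (let (p, q) = gqsp Rs; p' = (if Rs = [] then p else pCons 0 p) in
     (smult (R 0 0) p' + smult (R 0 1) q, smult (R 1 0) p' + smult (R 1 1) q))"

definition su2 :: "complex \<Rightarrow> complex \<Rightarrow> cmat" where
  "su2 u v = (\<lambda>i j. if i = 0 then (if j = 0 then u else - cnj v) else (if j = 0 then v else cnj u))"

lemma less_2_iff: "(\<forall>i<2. P i) \<longleftrightarrow> P 0 \<and> P (1::nat)"
  by (auto simp: less_2_cases_iff)

lemma sum_less_2: "(\<Sum>l<2. f l) = f 0 + f (1::nat)"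
  by (simp add: numeral_2_eq_2)

lemma unitary2_su2:
  assumes "(cmod u)\<^sup>2 + (cmod v)\<^sup>2 = 1" shows "unitary2 (su2 u v)"
proof -
  have "u * cnj u + v * cnj v = 1"
    using assms by (metis complex_norm_square of_real_1 of_real_add)
  then show ?thesis
    unfolding unitary2_def less_2_iff sum_less_2 by (simp add: su2_def mid_def algebra_simps)
qed

text \<open>The assumption says that the two coefficient vectors are orthogonal, so a unit vector
  parallel to (pn, qn) is orthogonal to (p0, q0). If (pn, qn) vanishes, parallelism is no constraint
  and any unit vector orthogonal to (p0, q0) serves.\<close>

lemma exists_splitting_unit_vector:
  fixes p0 q0 pn qn :: complex
  assumes "pn * cnj p0 + qn * cnj q0 = 0"
  shows "\<exists>u v. (cmod u)\<^sup>2 + (cmod v)\<^sup>2 = 1 \<and> cnj u * p0 + cnj v * q0 = 0 \<and> u * qn - v * pn = 0"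
proof -
  have norm: "(cmod (x / complex_of_real s))\<^sup>2 + (cmod (y / complex_of_real s))\<^sup>2 = 1 \<and> s > 0"
    if "(x, y) \<noteq> (0, 0)" "s = sqrt ((cmod x)\<^sup>2 + (cmod y)\<^sup>2)" for x y s
  proof -
    have "(cmod x)\<^sup>2 + (cmod y)\<^sup>2 > 0" using that(1) by (auto simp: sum_power2_gt_zero_iff)
    moreover have "x = 0 \<longrightarrow> y \<noteq> 0" using that(1) by simp
    moreover from calculation have "s > 0" "s\<^sup>2 = (cmod x)\<^sup>2 + (cmod y)\<^sup>2" using that(2) by auto
    ultimately show ?thesis by (simp add: norm_divide power_divide flip: add_divide_distrib)
  qed
  have conj: "p0 * cnj pn + q0 * cnj qn = 0"
    using arg_cong[OF assms, of cnj] by (simp add: mult.commute)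
  consider "(pn, qn) \<noteq> (0, 0)" | "pn = 0" "qn = 0" "(- cnj q0, cnj p0) \<noteq> (0, 0)"
    | "pn = 0" "qn = 0" "p0 = 0" "q0 = 0" by auto
  then show ?thesis
  proof cases
    case 1
    define s where "s = sqrt ((cmod pn)\<^sup>2 + (cmod qn)\<^sup>2)"
    show ?thesis
      by (rule exI[of _ "pn / complex_of_real s"], rule exI[of _ "qn / complex_of_real s"])
        (use norm[OF 1 s_def] conj in \<open>simp add: field_simps\<close>)
  next
    case 2
    define s where "s = sqrt ((cmod (- cnj q0))\<^sup>2 + (cmod (cnj p0))\<^sup>2)"
    show ?thesis
      by (rule exI[of _ "- cnj q0 / complex_of_real s"], rule exI[of _ "cnj p0 / complex_of_real s"])
        (use norm[OF 2(3) s_def] 2 in \<open>simp add: field_simps\<close>)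
  next
    case 3
    then show ?thesis by (intro exI[of _ 1] exI[of _ 0]) auto
  qed
qed

text \<open>The outermost rotation is peeled off. Its adjoint is chosen to kill the constant term of
  the first component, which can then be divided by z, and the leading term of the second. Both
  results obey the smaller degree bound, and the sum of squared moduli is preserved.\<close>

theorem gqsp_exists:
  assumes "degree P \<le> d" "degree Q \<le> d"
    and "\<And>z. cmod z = 1 \<Longrightarrow> (cmod (poly P z))\<^sup>2 + (cmod (poly Q z))\<^sup>2 = 1"
  shows "\<exists>Rs. length Rs = Suc d \<and> (\<forall>R\<in>set Rs. unitary2 R) \<and> gqsp Rs = (P, Q)"
  using assms
proof (induction d arbitrary: P Q)
  case 0
  obtain p q where pq: "P = [:p:]" "Q = [:q:]"
    using 0 degree_0_id by (metis le_zero_eq)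
  then have "unitary2 (su2 p q)" using 0(3)[of 1] by (intro unitary2_su2) simp
  then show ?case
    by (intro exI[of _ "[su2 p q]"]) (simp add: pq su2_def)
next
  case (Suc d)
  define n where "n = Suc d"
  have "P * crev n P + Q * crev n Q = monom 1 n"
  proof (rule poly_eq_on_circle)
    fix z :: complex assume z: "cmod z = 1"
    have "poly (P * crev n P + Q * crev n Q) z
        = z ^ n * (poly P z * cnj (poly P z) + poly Q z * cnj (poly Q z))"
      using Suc.prems z by (simp add: poly_crev_unit n_def algebra_simps)
    also have "\<dots> = z ^ n * complex_of_real ((cmod (poly P z))\<^sup>2 + (cmod (poly Q z))\<^sup>2)"
      by (simp only: complex_norm_square of_real_add)
    finally show "poly (P * crev n P + Q * crev n Q) z = poly (monom 1 n) z"
      using Suc.prems(3)[OF z] by (simp add: poly_monom)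
  qed
  \<comment> \<open>The constant coefficient of z^n is 0 since n > 0; on the other side it pairs
    constant with conjugated leading coefficients. This is the orthogonality needed for the
    split.\<close>
  from arg_cong[OF this, of "\<lambda>p. cnj (coeff p 0)"]
  have "coeff P n * cnj (coeff P 0) + coeff Q n * cnj (coeff Q 0) = 0"
    by (simp add: coeff_mult coeff_crev n_def mult.commute)
  from exists_splitting_unit_vector[OF this] obtain u v where
    uv: "(cmod u)\<^sup>2 + (cmod v)\<^sup>2 = 1" "cnj u * coeff P 0 + cnj v * coeff Q 0 = 0"
      "u * coeff Q n - v * coeff P n = 0" by blast
  have uv1: "u * cnj u + v * cnj v = 1"
    using uv(1) by (metis complex_norm_square of_real_1 of_real_add)
  define Q' where "Q' = smult u Q - smult v P"
  obtain P' where P': "smult (cnj u) P + smult (cnj v) Q = pCons 0 P'"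
    using uv(2) by (metis (no_types, lifting) coeff_add coeff_pCons_0 coeff_smult pCons_cases)
  have dP: "degree P' \<le> d"
  proof (rule degree_pCons_0_le)
    show "degree (pCons 0 P') \<le> Suc d" unfolding P'[symmetric]
      by (rule degree_add_le) (use Suc.prems degree_smult_le order_trans in blast)+
  qed
  have dQ: "degree Q' \<le> d"
  proof (rule degree_le, intro allI impI)
    fix i assume "d < i"
    show "coeff Q' i = 0"
    proof (cases "i = n")
      case True
      then show ?thesis using uv(3) by (simp add: Q'_def)
    next
      case False
      then have "i > degree P" "i > degree Q" using Suc.prems \<open>d < i\<close> n_def by linarith+
      then show ?thesis by (simp add: Q'_def coeff_eq_0)
    qed
  qed
  have eqs: "P = smult u (pCons 0 P') + smult (- cnj v) Q'" "Q = smult v (pCons 0 P') + smult (cnj u) Q'"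
  proof -
    have "smult u (pCons 0 P') + smult (- cnj v) Q' = smult (u * cnj u + v * cnj v) P"
      unfolding P'[symmetric] Q'_def
      by (simp add: smult_add_right smult_diff_right algebra_simps smult_add_left)
    then show "P = smult u (pCons 0 P') + smult (- cnj v) Q'" using uv1 by simp
    have "smult v (pCons 0 P') + smult (cnj u) Q' = smult (u * cnj u + v * cnj v) Q"
      unfolding P'[symmetric] Q'_def
      by (simp add: smult_add_right smult_diff_right algebra_simps smult_add_left)
    then show "Q = smult v (pCons 0 P') + smult (cnj u) Q'" using uv1 by simp
  qed
  have "(cmod (poly P' z))\<^sup>2 + (cmod (poly Q' z))\<^sup>2 = 1" if z: "cmod z = 1" for z
  proof -
    let ?p = "poly P z" and ?q = "poly Q z"
    have a: "poly (pCons 0 P') z = cnj u * ?p + cnj v * ?q" unfolding P'[symmetric] by simp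
    have b: "poly Q' z = u * ?q - v * ?p" by (simp add: Q'_def)
    have "complex_of_real ((cmod (poly (pCons 0 P') z))\<^sup>2 + (cmod (poly Q' z))\<^sup>2)
      = (u * cnj u + v * cnj v) * (?p * cnj ?p + ?q * cnj ?q)"
      unfolding a b of_real_add complex_norm_square by (simp add: algebra_simps)
    also have "\<dots> = complex_of_real ((cmod ?p)\<^sup>2 + (cmod ?q)\<^sup>2)"
      using uv1 by (simp only: of_real_add complex_norm_square mult_1)
    finally have "(cmod (poly (pCons 0 P') z))\<^sup>2 + (cmod (poly Q' z))\<^sup>2 = 1"
      using Suc.prems(3)[OF z] by (metis of_real_eq_iff)
    then show ?thesis using z by (simp add: norm_mult)
  qed
  then obtain Rs where Rs: "length Rs = Suc d" "\<forall>R\<in>set Rs. unitary2 R" "gqsp Rs = (P', Q')"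
    using Suc.IH[OF dP dQ] by blast
  have "gqsp (su2 u v # Rs) = (P, Q)" using Rs eqs by (auto simp: su2_def Let_def)
  then show ?case using Rs unitary2_su2[OF uv(1)] by (intro exI[of _ "su2 u v # Rs"]) auto
qed

section \<open>Gates as operators on functions of bit assignments\<close>

text \<open>Operators act on functions of all bit assignments, not only those supported on the first
  \<open>N\<close> qubits, so that operator identities hold without range conditions.\<close>

type_synonym state = "(nat \<Rightarrow> bool) \<Rightarrow> complex"

definition bits :: "nat \<Rightarrow> nat \<Rightarrow> bool" where
  "bits r = (\<lambda>j. bitn r j = 1)"

definition assignments :: "nat \<Rightarrow> (nat \<Rightarrow> bool) set" where
  "assignments N = {\<beta>. \<forall>j\<ge>N. \<not> \<beta> j}"

lemma bits_iff: "bits r j \<longleftrightarrow> bit r j"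
  by (simp add: bits_def bitn_def bit_iff_odd odd_iff_mod_2_eq_one)

lemma bitn_eq: "bitn r j = of_bool (bits r j)"
  by (auto simp: bits_def bitn_def)

lemma bits_less: "r < 2 ^ N \<Longrightarrow> bits r \<in> assignments N"
proof -
  assume r: "r < 2 ^ N"
  have "\<not> bits r j" if "N \<le> j" for j
  proof -
    have "(2::nat) ^ N \<le> 2 ^ j" using that by (intro power_increasing) auto
    then have "r div 2 ^ j = 0" using r by (intro div_less) linarith
    then show ?thesis by (simp add: bits_def bitn_def)
  qed
  then show ?thesis by (simp add: assignments_def)
qed

lemma bij_betw_bits: "bij_betw bits {..<2 ^ N} (assignments N)"
proof -
  have inj: "inj_on bits {..<2 ^ N}"
    by (auto intro!: inj_onI bit_eqI simp: bits_iff fun_eq_iff)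
  moreover have "bits ` {..<2 ^ N} = assignments N"
  proof (intro equalityI subsetI)
    fix \<beta> assume "\<beta> \<in> bits ` {..<2 ^ N}"
    then show "\<beta> \<in> assignments N" using bits_less by auto
  next
    fix \<beta> assume b: "\<beta> \<in> assignments N"
    define r where "r = (\<Sum>i<N. of_bool (\<beta> i) * 2 ^ i :: nat)"
    have r: "r = horner_sum of_bool 2 (map \<beta> [0..<N])"
      by (simp add: r_def horner_sum_eq_sum atLeast0LessThan)
    have "bits r = \<beta>"
    proof
      fix j show "bits r j = \<beta> j"
        using b by (cases "j < N") (auto simp: bits_iff r bit_horner_sum_bit_iff assignments_def not_less)
    qed
    moreover have "r < 2 ^ N"
      using horner_sum_of_bool_2_less[of "map \<beta> [0..<N]"] by (simp add: r)
    ultimately show "\<beta> \<in> bits ` {..<2 ^ N}" by auto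
  qed
  ultimately show ?thesis by (simp add: bij_betw_def)
qed

lemma finite_assignments [simp]: "finite (assignments N)"
  using bij_betw_finite[OF bij_betw_bits[of N]] by simp

lemma sum_bits: "(\<Sum>r<2 ^ N. F (bits r)) = sum F (assignments N)"
  by (rule sum.reindex_bij_betw[OF bij_betw_bits])

fun pauli_flip :: "pauli \<Rightarrow> bool" where
  "pauli_flip PI = False" | "pauli_flip PX = True" | "pauli_flip PY = True" | "pauli_flip PZ = False"

definition pstr_flip :: "pstring \<Rightarrow> (nat \<Rightarrow> bool) \<Rightarrow> nat \<Rightarrow> bool" where
  "pstr_flip P \<beta> = (\<lambda>j. \<beta> j \<noteq> pauli_flip (P j))"

text \<open>A Pauli string is a monomial matrix: the row of \<beta> has one nonzero entry, of
  modulus one, in the column of \<open>pstr_flip P \<beta>\<close>. The phase is that entry.\<close>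

definition pstr_phase :: "nat \<Rightarrow> pstring \<Rightarrow> (nat \<Rightarrow> bool) \<Rightarrow> complex" where
  "pstr_phase N P \<beta> =
    (\<Prod>j<N. pauli_mat (P j) (of_bool (\<beta> j)) (of_bool (\<beta> j \<noteq> pauli_flip (P j))))"

definition pauli_op :: "nat \<Rightarrow> pstring \<Rightarrow> state \<Rightarrow> state" where
  "pauli_op N P \<psi> \<beta> = pstr_phase N P \<beta> * \<psi> (pstr_flip P \<beta>)"

fun base_op :: "nat \<Rightarrow> base_gate \<Rightarrow> state \<Rightarrow> state" where
  "base_op N (U1 q U) \<psi> = (\<lambda>\<beta>. U (of_bool (\<beta> q)) 0 * \<psi> (\<beta>(q := False)) +
     U (of_bool (\<beta> q)) 1 * \<psi> (\<beta>(q := True)))"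
| "base_op N (PStr P) \<psi> = pauli_op N P \<psi>"

definition controls :: "(nat \<times> bool) list \<Rightarrow> (nat \<Rightarrow> bool) \<Rightarrow> bool" where
  "controls cs \<beta> \<longleftrightarrow> (\<forall>(q, v)\<in>set cs. \<beta> q = v)"

definition gate_op :: "nat \<Rightarrow> gate \<Rightarrow> state \<Rightarrow> state" where
  "gate_op N g \<psi> = (\<lambda>\<beta>. if controls (fst g) \<beta> then base_op N (snd g) \<psi> \<beta> else \<psi> \<beta>)"

definition circuit_op :: "nat \<Rightarrow> gate list \<Rightarrow> state \<Rightarrow> state" where
  "circuit_op N gs = fold (gate_op N) gs"

lemma circuit_op_Nil [simp]: "circuit_op N [] \<psi> = \<psi>"
  and circuit_op_Cons [simp]: "circuit_op N (g # gs) \<psi> = circuit_op N gs (gate_op N g \<psi>)"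
  and circuit_op_append [simp]: "circuit_op N (gs @ hs) \<psi> = circuit_op N hs (circuit_op N gs \<psi>)"
  by (simp_all add: circuit_op_def)

lemma pauli_mat_nonflip:
  "b' \<noteq> (b \<noteq> pauli_flip p) \<Longrightarrow> pauli_mat p (of_bool b) (of_bool b') = 0"
  by (cases p) (auto split: if_splits)

lemma pauli_mat_phase_mult:
  "pauli_mat p (of_bool b) (of_bool (b \<noteq> pauli_flip p)) *
   pauli_mat p (of_bool (b \<noteq> pauli_flip p)) (of_bool b) = 1"
  by (cases p; cases b) auto

lemma cmod_pauli_mat_phase: "cmod (pauli_mat p (of_bool b) (of_bool (b \<noteq> pauli_flip p))) = 1"
  by (cases p; cases b) auto

lemma cmod_pstr_phase: "cmod (pstr_phase N P \<beta>) = 1"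
  unfolding pstr_phase_def prod_norm[symmetric] by (intro prod.neutral ballI cmod_pauli_mat_phase)

lemma pstr_flip_flip [simp]: "pstr_flip P (pstr_flip P \<beta>) = \<beta>"
  by (auto simp: pstr_flip_def)

lemma pstr_flip_outside: "pstr_supp P \<subseteq> A \<Longrightarrow> j \<notin> A \<Longrightarrow> pstr_flip P \<beta> j = \<beta> j"
  by (cases "P j = PI") (auto simp: pstr_flip_def pstr_supp_def)

lemma pstr_flip_assignments:
  assumes "pstr_supp P \<subseteq> {..<N}" shows "pstr_flip P \<beta> \<in> assignments N \<longleftrightarrow> \<beta> \<in> assignments N"
  using pstr_flip_outside[OF assms, of _ \<beta>] by (auto simp: assignments_def)

lemma pauli_op_involution: "pauli_op N P (pauli_op N P \<psi>) = \<psi>"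
proof
  fix \<beta>
  have b: "((b \<noteq> f) \<noteq> f) = b" for b f by auto
  have "pstr_phase N P \<beta> * pstr_phase N P (pstr_flip P \<beta>) = 1"
    unfolding pstr_phase_def prod.distrib[symmetric] pstr_flip_def b
    by (intro prod.neutral ballI pauli_mat_phase_mult)
  then show "pauli_op N P (pauli_op N P \<psi>) \<beta> = \<psi> \<beta>"
    by (simp add: pauli_op_def flip: mult.assoc)
qed

lemma pstr_phase_mono:
  assumes "pstr_supp P \<subseteq> {..<m}" "m \<le> N" shows "pstr_phase N P = pstr_phase m P"
proof
  fix \<beta> show "pstr_phase N P \<beta> = pstr_phase m P \<beta>" unfolding pstr_phase_def
    by (rule prod.mono_neutral_right)
      (use assms in \<open>auto simp: pstr_supp_def not_less split: if_splits\<close>, (metis (mono_tags) mem_Collect_eq lessThan_iff not_le subsetD pauli_mat.simps(1) pauli_flip.simps(1))+)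
qed

lemma pauli_op_mono:
  assumes "pstr_supp P \<subseteq> {..<m}" "m \<le> N" shows "pauli_op N P = pauli_op m P"
  using pstr_phase_mono[OF assms] by (intro ext) (simp add: pauli_op_def)

lemma pstr_phase_cong:
  assumes "\<And>j. j < N \<Longrightarrow> \<beta> j = \<beta>' j" shows "pstr_phase N P \<beta> = pstr_phase N P \<beta>'"
  unfolding pstr_phase_def by (rule prod.cong) (use assms in auto)

lemma pstr_mat_apply:
  assumes P: "pstr_supp P \<subseteq> {..<N}" and r: "r < 2 ^ N"
  shows "(\<Sum>c<2 ^ N. pstr_mat N P r c * \<psi> (bits c)) = pauli_op N P \<psi> (bits r)"
proof -
  define F where "F \<beta> = (\<Prod>j<N. pauli_mat (P j) (of_bool (bits r j)) (of_bool (\<beta> j))) * \<psi> \<beta>" for \<beta>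
  have F0: "F \<beta> = 0" if \<beta>: "\<beta> \<in> assignments N" "\<beta> \<noteq> pstr_flip P (bits r)" for \<beta>
  proof -
    have "pstr_flip P (bits r) \<in> assignments N"
      using bits_less[OF r] P by (simp add: pstr_flip_assignments)
    moreover obtain j where "\<beta> j \<noteq> pstr_flip P (bits r) j" using \<beta>(2) by blast
    ultimately have j: "j < N" "\<beta> j \<noteq> pstr_flip P (bits r) j"
      using \<beta>(1) by (auto simp: assignments_def not_less[symmetric])
    then have "pauli_mat (P j) (of_bool (bits r j)) (of_bool (\<beta> j)) = 0"
      by (intro pauli_mat_nonflip) (auto simp: pstr_flip_def)
    then have "(\<Prod>j<N. pauli_mat (P j) (of_bool (bits r j)) (of_bool (\<beta> j))) = 0"
      using j(1) by (intro prod_zero[OF _ bexI[of _ j]]) auto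
    then show ?thesis by (simp add: F_def)
  qed
  have "(\<Sum>c<2 ^ N. pstr_mat N P r c * \<psi> (bits c)) = (\<Sum>c<2 ^ N. F (bits c))"
    by (simp add: pstr_mat_def F_def bitn_eq)
  also have "\<dots> = sum F (assignments N)" by (rule sum_bits)
  also have "\<dots> = sum F {pstr_flip P (bits r)}"
    by (rule sum.mono_neutral_right)
      (use F0 bits_less[OF r] P in \<open>auto simp: pstr_flip_assignments\<close>)
  also have "\<dots> = pauli_op N P \<psi> (bits r)"
    by (simp add: F_def pauli_op_def pstr_phase_def pstr_flip_def)
  finally show ?thesis .
qed

lemma pstr_mat_nonzero_imp:
  assumes "pstr_mat N P r c \<noteq> 0" "j < N" "P j = PI" shows "bits c j = bits r j"
proof (rule ccontr)
  assume "bits c j \<noteq> bits r j"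
  then have "pauli_mat (P j) (bitn r j) (bitn c j) = 0"
    unfolding bitn_eq by (intro pauli_mat_nonflip) (use assms in auto)
  then show False using assms(1,2) by (auto simp: pstr_mat_def)
qed

lemma U1_apply:
  assumes q: "q < N" and r: "r < 2 ^ N"
  shows "(\<Sum>c<2 ^ N. base_entry N (U1 q U) r c * \<psi> (bits c)) = base_op N (U1 q U) \<psi> (bits r)"
proof -
  let ?\<rho> = "bits r"
  define F where "F \<beta> = (if \<forall>j<N. j \<noteq> q \<longrightarrow> ?\<rho> j = \<beta> j
    then U (of_bool (?\<rho> q)) (of_bool (\<beta> q)) else 0) * \<psi> \<beta>" for \<beta>
  have \<rho>: "?\<rho> \<in> assignments N" by (rule bits_less[OF r])
  have F0: "F \<beta> = 0" if "\<beta> \<in> assignments N" "\<beta> \<notin> {?\<rho>(q := False), ?\<rho>(q := True)}" for \<beta>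
  proof -
    have "\<beta> \<noteq> ?\<rho>(q := \<beta> q)" using that(2) by (cases "\<beta> q") auto
    then obtain j where "\<beta> j \<noteq> (?\<rho>(q := \<beta> q)) j" by blast
    then have "j \<noteq> q" "\<beta> j \<noteq> ?\<rho> j" by (auto split: if_splits)
    moreover from this have "j < N" using \<rho> that(1) by (auto simp: assignments_def not_less[symmetric])
    ultimately show ?thesis by (auto simp: F_def)
  qed
  have ne: "?\<rho>(q := False) \<noteq> ?\<rho>(q := True)" by (auto simp: fun_eq_iff)
  have "(\<Sum>c<2 ^ N. base_entry N (U1 q U) r c * \<psi> (bits c)) = (\<Sum>c<2 ^ N. F (bits c))"
    by (simp only: F_def bitn_eq base_entry.simps of_bool_eq_iff)
  also have "\<dots> = sum F (assignments N)" by (rule sum_bits)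
  also have "\<dots> = sum F {?\<rho>(q := False), ?\<rho>(q := True)}"
    by (rule sum.mono_neutral_right[OF finite_assignments]) (use F0 \<rho> q in \<open>auto simp: assignments_def\<close>)
  also have "\<dots> = base_op N (U1 q U) \<psi> ?\<rho>"
    using ne by (simp add: F_def)
  finally show ?thesis .
qed

lemma base_apply:
  assumes "base_supp b \<subseteq> {..<N}" "r < 2 ^ N"
  shows "(\<Sum>c<2 ^ N. base_entry N b r c * \<psi> (bits c)) = base_op N b \<psi> (bits r)"
proof (cases b)
  case (U1 q U)
  then show ?thesis using U1_apply[of q N r U \<psi>] assms by auto
next
  case (PStr P)
  then show ?thesis using pstr_mat_apply[of P N r \<psi>] assms by auto
qed

lemma base_entry_nonzero_imp:
  assumes "base_entry N b r c \<noteq> 0" "j < N" "j \<notin> base_supp b" shows "bits c j = bits r j"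
proof (cases b)
  case (U1 q U)
  then show ?thesis using assms by (auto simp: bits_def split: if_splits)
next
  case (PStr P)
  then show ?thesis using assms pstr_mat_nonzero_imp by (auto simp: pstr_supp_def)
qed

text \<open>The matrix tests the controls on the column, the operator on the row. The two tests
  agree because a valid gate acts off its control qubits, so row and column of a nonzero entry
  coincide there.\<close>

lemma gate_apply:
  assumes ok: "gate_ok N g" and r: "r < 2 ^ N"
  shows "(\<Sum>c<2 ^ N. gate_mat N g r c * \<psi> (bits c)) = gate_op N g \<psi> (bits r)"
proof -
  have ctrl: "(\<forall>(q, v)\<in>set (fst g). (bitn c q = 1) = v) \<longleftrightarrow> controls (fst g) (bits c)" for c
    by (simp add: controls_def bits_def)
  have same: "controls (fst g) (bits c) \<longleftrightarrow> controls (fst g) (bits r)"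
    if "base_entry N (snd g) r c \<noteq> 0" for c
  proof -
    have "bits c q = bits r q" if "(q, v) \<in> set (fst g)" for q v
      by (rule base_entry_nonzero_imp[OF \<open>base_entry N (snd g) r c \<noteq> 0\<close>])
        (use ok that in \<open>force simp: gate_ok_def\<close>)+
    then show ?thesis by (auto simp: controls_def)
  qed
  show ?thesis
  proof (cases "controls (fst g) (bits r)")
    case True
    have "gate_mat N g r c = base_entry N (snd g) r c" for c
      using True same[of c] unfolding gate_mat_def ctrl by auto
    then show ?thesis
      using True base_apply[of "snd g" N r \<psi>] ok r by (simp add: gate_op_def gate_ok_def)
  next
    case False
    have "gate_mat N g r c = (if r = c then 1 else 0)" for c
      using False same[of c] unfolding gate_mat_def ctrl by auto
    then show ?thesis
      using False r by (simp add: gate_op_def if_distrib[of "\<lambda>x. x * _"] cong: if_cong)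
  qed
qed

text \<open>Bridge from the circuit matrices of the statement to operators: entries are recovered
  later by applying the operator to suitable functions of the bits.\<close>

lemma circuit_apply:
  assumes "\<forall>g\<in>set gs. gate_ok N g" "r < 2 ^ N"
  shows "(\<Sum>c<2 ^ N. circuit_mat N gs r c * \<psi> (bits c)) = circuit_op N gs \<psi> (bits r)"
  using assms
proof (induction gs arbitrary: \<psi>)
  case Nil
  then show ?case by (simp add: mid_def if_distrib[of "\<lambda>x. x * _"] cong: if_cong)
next
  case (Cons g gs)
  have "(\<Sum>c<2 ^ N. circuit_mat N (g # gs) r c * \<psi> (bits c))
      = (\<Sum>l<2 ^ N. circuit_mat N gs r l * (\<Sum>c<2 ^ N. gate_mat N g l c * \<psi> (bits c)))"
    by (simp add: mmul_def sum_distrib_left sum_distrib_right mult.assoc)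
      (rule sum.swap)
  also have "\<dots> = (\<Sum>l<2 ^ N. circuit_mat N gs r l * gate_op N g \<psi> (bits l))"
    using Cons.prems gate_apply by (intro sum.cong refl) auto
  also have "\<dots> = circuit_op N (g # gs) \<psi> (bits r)" using Cons by simp
  finally show ?case .
qed

section \<open>Linear operators and controlled circuits\<close>

definition linear_op :: "(state \<Rightarrow> state) \<Rightarrow> bool" where
  "linear_op W \<longleftrightarrow> (\<forall>\<phi> \<psi> c. W (\<lambda>\<beta>. \<phi> \<beta> + c * \<psi> \<beta>) = (\<lambda>\<beta>. W \<phi> \<beta> + c * W \<psi> \<beta>))"

lemma linear_opD: "linear_op W \<Longrightarrow> W (\<lambda>\<beta>. \<phi> \<beta> + c * \<psi> \<beta>) = (\<lambda>\<beta>. W \<phi> \<beta> + c * W \<psi> \<beta>)"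
  by (simp add: linear_op_def)

lemma linear_op_zero: "linear_op W \<Longrightarrow> W (\<lambda>_. 0) = (\<lambda>_. 0)"
  using linear_opD[of W "\<lambda>_. 0" "-1" "\<lambda>_. 0"] by simp

lemma linear_op_scale: "linear_op W \<Longrightarrow> W (\<lambda>\<beta>. c * \<psi> \<beta>) = (\<lambda>\<beta>. c * W \<psi> \<beta>)"
  using linear_opD[of W "\<lambda>_. 0" c \<psi>] linear_op_zero[of W] by simp

lemma linear_op_sum:
  assumes "linear_op W" "finite I"
  shows "W (\<lambda>\<beta>. \<Sum>i\<in>I. c i * \<psi> i \<beta>) = (\<lambda>\<beta>. \<Sum>i\<in>I. c i * W (\<psi> i) \<beta>)"
  using assms(2)
proof (induction I rule: finite_induct)
  case empty
  then show ?case using linear_op_zero[OF assms(1)] by simp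
next
  case (insert x I)
  then have "W (\<lambda>\<beta>. \<Sum>i\<in>insert x I. c i * \<psi> i \<beta>)
      = W (\<lambda>\<beta>. (\<Sum>i\<in>I. c i * \<psi> i \<beta>) + c x * \<psi> x \<beta>)"
    by (simp add: add.commute)
  also have "\<dots> = (\<lambda>\<beta>. (\<Sum>i\<in>I. c i * W (\<psi> i) \<beta>) + c x * W (\<psi> x) \<beta>)"
    unfolding linear_opD[OF assms(1)] insert.IH ..
  finally show ?case using insert.hyps by (simp add: add.commute)
qed

lemma linear_op_funpow: "linear_op W \<Longrightarrow> linear_op (W ^^ n)"
  by (induction n) (auto simp: linear_op_def)

lemma linear_base_op: "linear_op (base_op N b)"
  by (cases b) (auto simp: linear_op_def pauli_op_def fun_eq_iff algebra_simps)

lemma linear_gate_op: "linear_op (gate_op N g)"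
  using linear_base_op[of N "snd g"] by (auto simp: linear_op_def gate_op_def fun_eq_iff)

lemma linear_circuit_op: "linear_op (circuit_op N gs)"
proof (induction gs)
  case Nil
  then show ?case by (simp add: linear_op_def)
next
  case (Cons g gs)
  then show ?case using linear_gate_op[of N g] by (simp add: linear_op_def)
qed

text \<open>A gate acting off Q keeps the branches with different values on Q apart, so its output
  at \<beta> reads input values from the branch of \<beta> only. Inputs can therefore be replaced
  branch by branch.\<close>

lemma base_op_local:
  assumes "base_supp b \<inter> Q = {}" "\<And>\<beta>'. \<forall>j\<in>Q. \<beta>' j = \<beta> j \<Longrightarrow> \<psi> \<beta>' = \<psi>' \<beta>'"
  shows "base_op N b \<psi> \<beta> = base_op N b \<psi>' \<beta>"
proof (cases b)
  case (U1 q U)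
  then have "\<psi> (\<beta>(q := v)) = \<psi>' (\<beta>(q := v))" for v
    using assms by (intro assms(2)) auto
  then show ?thesis using U1 by simp
next
  case (PStr P)
  have "pstr_flip P \<beta> j = \<beta> j" if "j \<in> Q" for j
    using pstr_flip_outside[of P "- Q" j \<beta>] that assms(1) PStr by auto
  then have "\<psi> (pstr_flip P \<beta>) = \<psi>' (pstr_flip P \<beta>)" by (intro assms(2)) auto
  then show ?thesis using PStr by (simp add: pauli_op_def)
qed

lemma circuit_op_local:
  assumes "\<And>g. g \<in> set gs \<Longrightarrow> base_supp (snd g) \<inter> Q = {}"
    and "\<And>\<beta>'. \<forall>j\<in>Q. \<beta>' j = \<beta> j \<Longrightarrow> \<psi> \<beta>' = \<psi>' \<beta>'"
  shows "circuit_op N gs \<psi> \<beta> = circuit_op N gs \<psi>' \<beta>"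
  using assms
proof (induction gs arbitrary: \<psi> \<psi>')
  case Nil
  then show ?case by simp
next
  case (Cons g gs)
  have "gate_op N g \<psi> \<beta>' = gate_op N g \<psi>' \<beta>'" if "\<forall>j\<in>Q. \<beta>' j = \<beta> j" for \<beta>'
    using base_op_local[of "snd g" Q \<beta>' \<psi> \<psi>' N] Cons.prems that by (auto simp: gate_op_def)
  then show ?case unfolding circuit_op_Cons by (intro Cons.IH) (use Cons.prems in auto)
qed

text \<open>Used for the signal qubit: powers of the walk must take equal values at both settings of
  that qubit, so that a rotation of it merely mixes scalar coefficients.\<close>

lemma circuit_op_indep:
  assumes "\<And>g. g \<in> set gs \<Longrightarrow> q \<notin> base_supp (snd g) \<and> q \<notin> fst ` set (fst g)"
    and "\<And>\<beta>. \<psi> (\<beta>(q := v)) = \<psi> \<beta>"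
  shows "circuit_op N gs \<psi> (\<beta>(q := v)) = circuit_op N gs \<psi> \<beta>"
  using assms
proof (induction gs arbitrary: \<psi> \<beta>)
  case Nil
  then show ?case by simp
next
  case (Cons g gs)
  have q: "q \<notin> base_supp (snd g)" "q \<notin> fst ` set (fst g)" using Cons.prems by auto
  have c: "controls (fst g) (\<beta>(q := v)) = controls (fst g) \<beta>" for \<beta>
    unfolding controls_def case_prod_beta
    by (rule ball_cong) (use q(2) in \<open>auto simp: image_iff\<close>)
  have b: "base_op N (snd g) \<psi> (\<beta>(q := v)) = base_op N (snd g) \<psi> \<beta>" for \<beta>
  proof (cases "snd g")
    case (U1 p U)
    then have "q \<noteq> p" using q by simp
    have "\<psi> (\<beta>(q := v, p := w)) = \<psi> (\<beta>(p := w))" for w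
      unfolding fun_upd_twist[OF \<open>q \<noteq> p\<close>, of \<beta> v w] by (rule Cons.prems(2))
    then show ?thesis using U1 \<open>q \<noteq> p\<close> by simp
  next
    case (PStr P)
    then have "P q = PI" using q by (auto simp: pstr_supp_def)
    then have "pstr_flip P (\<beta>(q := v)) = (pstr_flip P \<beta>)(q := v)"
      by (auto simp: pstr_flip_def fun_eq_iff)
    moreover have "pstr_phase N P (\<beta>(q := v)) = pstr_phase N P \<beta>"
      unfolding pstr_phase_def by (rule prod.cong) (use \<open>P q = PI\<close> in auto)
    moreover have "\<psi> ((pstr_flip P \<beta>)(q := v)) = \<psi> (pstr_flip P \<beta>)" by (rule Cons.prems(2))
    ultimately show ?thesis by (simp only: PStr base_op.simps pauli_op_def)
  qed
  have g: "gate_op N g \<psi> (\<beta>(q := v)) = gate_op N g \<psi> \<beta>" for \<beta>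
    by (simp only: gate_op_def c b Cons.prems(2))
  show ?case unfolding circuit_op_Cons
  proof (rule Cons.IH)
    show "q \<notin> base_supp (snd h) \<and> q \<notin> fst ` set (fst h)" if "h \<in> set gs" for h
      using Cons.prems(1)[of h] that by simp
    show "gate_op N g \<psi> (\<beta>(q := v)) = gate_op N g \<psi> \<beta>" for \<beta> by (rule g)
  qed
qed

definition ctrl :: "(nat \<times> bool) list \<Rightarrow> gate list \<Rightarrow> gate list" where
  "ctrl cs = map (\<lambda>g. (cs @ fst g, snd g))"

lemma controls_append [simp]: "controls (cs @ ds) \<beta> \<longleftrightarrow> controls cs \<beta> \<and> controls ds \<beta>"
  by (auto simp: controls_def)

lemma controls_Nil [simp]: "controls [] \<beta>"
  by (simp add: controls_def)

text \<open>No gate changes a qubit of \<open>cs\<close>, so these controls have the same truth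
  value at every gate and the circuit is run or skipped as a whole.\<close>

lemma circuit_op_ctrl:
  assumes "\<And>g. g \<in> set gs \<Longrightarrow> base_supp (snd g) \<inter> fst ` set cs = {}"
  shows "circuit_op N (ctrl cs gs) \<psi> \<beta> = (if controls cs \<beta> then circuit_op N gs \<psi> \<beta> else \<psi> \<beta>)"
  using assms
proof (induction gs arbitrary: \<psi>)
  case Nil
  then show ?case by (simp add: ctrl_def)
next
  case (Cons g gs)
  let ?h = "(cs @ fst g, snd g)"
  have "circuit_op N (ctrl cs (g # gs)) \<psi> \<beta>
    = (if controls cs \<beta> then circuit_op N gs (gate_op N ?h \<psi>) \<beta> else gate_op N ?h \<psi> \<beta>)"
    using Cons by (simp add: ctrl_def)
  also have "\<dots> = (if controls cs \<beta> then circuit_op N gs (gate_op N g \<psi>) \<beta> else \<psi> \<beta>)"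
  proof (cases "controls cs \<beta>")
    case True
    have "controls cs \<beta>'" if "\<forall>j\<in>fst ` set cs. \<beta>' j = \<beta> j" for \<beta>'
      using True that by (fastforce simp: controls_def)
    then have "circuit_op N gs (gate_op N ?h \<psi>) \<beta> = circuit_op N gs (gate_op N g \<psi>) \<beta>"
      by (intro circuit_op_local[of gs "fst ` set cs"]) (use Cons.prems in \<open>auto simp: gate_op_def\<close>)
    then show ?thesis using True by simp
  next
    case False
    then show ?thesis by (simp add: gate_op_def)
  qed
  finally show ?case by simp
qed

lemma circuit_cost_append [simp]: "circuit_cost (gs @ hs) = circuit_cost gs + circuit_cost hs"
  and circuit_cost_Nil [simp]: "circuit_cost [] = 0"
  and circuit_cost_Cons [simp]: "circuit_cost (g # gs) = gate_cost g + circuit_cost gs"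
  by (simp_all add: circuit_cost_def)

lemma length_le_circuit_cost: "length gs \<le> circuit_cost gs"
  by (induction gs) (auto simp: gate_cost_def)

lemma circuit_cost_ctrl: "circuit_cost (ctrl cs gs) = circuit_cost gs + length cs * length gs"
  by (induction gs) (auto simp: ctrl_def gate_cost_def)

section \<open>Polynomials in an operator and the circuits that realise them\<close>

definition poly_op :: "complex poly \<Rightarrow> (state \<Rightarrow> state) \<Rightarrow> state \<Rightarrow> state" where
  "poly_op p W \<psi> = (\<lambda>\<beta>. \<Sum>i\<le>degree p. coeff p i * (W ^^ i) \<psi> \<beta>)"

lemma poly_op_eq:
  assumes "degree p \<le> n" shows "poly_op p W \<psi> = (\<lambda>\<beta>. \<Sum>i\<le>n. coeff p i * (W ^^ i) \<psi> \<beta>)"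
  unfolding poly_op_def
  by (intro ext sum.mono_neutral_left) (use assms le_degree in auto)

lemma poly_op_0 [simp]: "poly_op 0 W \<psi> = (\<lambda>_. 0)"
  and poly_op_1 [simp]: "poly_op 1 W \<psi> = \<psi>"
  by (simp_all add: poly_op_def)

lemma poly_op_add: "poly_op (p + q) W \<psi> = (\<lambda>\<beta>. poly_op p W \<psi> \<beta> + poly_op q W \<psi> \<beta>)"
proof -
  let ?n = "max (degree p) (degree q)"
  have "degree (p + q) \<le> ?n" by (rule degree_add_le_max)
  then show ?thesis
    using poly_op_eq[of p ?n] poly_op_eq[of q ?n] poly_op_eq[of "p + q" ?n]
    by (simp add: sum.distrib distrib_right)
qed

lemma poly_op_smult: "poly_op (smult c p) W \<psi> = (\<lambda>\<beta>. c * poly_op p W \<psi> \<beta>)"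
  using poly_op_eq[of p "degree p"] poly_op_eq[of "smult c p" "degree p"]
  by (simp add: sum_distrib_left mult.assoc degree_smult_le)

lemma poly_op_sum:
  "finite I \<Longrightarrow> poly_op (\<Sum>i\<in>I. p i) W \<psi> = (\<lambda>\<beta>. \<Sum>i\<in>I. poly_op (p i) W \<psi> \<beta>)"
  by (induction I rule: finite_induct) (auto simp: poly_op_add)

lemma poly_op_pCons_0:
  assumes "linear_op W" shows "poly_op (pCons 0 p) W \<psi> = W (poly_op p W \<psi>)"
proof -
  have "poly_op (pCons 0 p) W \<psi> = (\<lambda>\<beta>. \<Sum>i\<le>Suc (degree p). coeff (pCons 0 p) i * (W ^^ i) \<psi> \<beta>)"
    by (rule poly_op_eq) (rule degree_pCons_le)
  also have "\<dots> = (\<lambda>\<beta>. \<Sum>i\<le>degree p. coeff p i * W ((W ^^ i) \<psi>) \<beta>)"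
    by (simp add: sum.atMost_Suc_shift del: sum.atMost_Suc)
  also have "\<dots> = W (\<lambda>\<beta>. \<Sum>i\<le>degree p. coeff p i * (W ^^ i) \<psi> \<beta>)"
    by (rule linear_op_sum[OF assms, symmetric]) simp
  finally show ?thesis by (simp add: poly_op_def)
qed

lemma poly_op_shift:
  assumes "linear_op W" shows "poly_op ((pCons 0 ^^ n) p) W \<psi> = (W ^^ n) (poly_op p W \<psi>)"
  by (induction n) (auto simp: poly_op_pCons_0[OF assms])

text \<open>Mirrors \<open>gqsp\<close>: the head of the list is the outermost factor and so comes
  last in time. The walk is controlled on value 0 because z multiplies the first component.\<close>

fun gqsp_circuit :: "nat \<Rightarrow> gate list \<Rightarrow> cmat list \<Rightarrow> gate list" where
  "gqsp_circuit q ws [] = []"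
| "gqsp_circuit q ws (R # Rs) =
     gqsp_circuit q ws Rs @ (if Rs = [] then [] else ctrl [(q, False)] ws) @ [([], U1 q R)]"

text \<open>The recursion of \<open>gqsp\<close> with z replaced by W. The two settings of the
  signal qubit carry the two components; the controlled walk acts on the first one only, and a
  rotation mixes them linearly because neither depends on that qubit.\<close>

lemma circuit_op_gqsp:
  fixes \<phi> :: state and N :: nat
  assumes ws: "\<And>g. g \<in> set ws \<Longrightarrow> q \<notin> base_supp (snd g) \<and> q \<notin> fst ` set (fst g)"
    and \<phi>: "\<And>\<beta> v. \<phi> (\<beta>(q := v)) = \<phi> \<beta>"
  defines "W \<equiv> circuit_op N ws"
  shows "circuit_op N (gqsp_circuit q ws Rs) (\<lambda>\<beta>. if \<beta> q then 0 else \<phi> \<beta>) =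
    (\<lambda>\<beta>. if \<beta> q then poly_op (snd (gqsp Rs)) W \<phi> \<beta> else poly_op (fst (gqsp Rs)) W \<phi> \<beta>)"
proof (induction Rs)
  case Nil
  show ?case by (rule ext) simp
next
  case (Cons R Rs)
  obtain P Q where PQ: "gqsp Rs = (P, Q)" by (rule prod.exhaust)
  define P' where "P' = (if Rs = [] then P else pCons 0 P)"
  have W: "linear_op W" unfolding W_def by (rule linear_circuit_op)
  have pow: "(W ^^ n) \<phi> (\<beta>(q := v)) = (W ^^ n) \<phi> \<beta>" for n \<beta> v
  proof (induction n arbitrary: \<beta>)
    case 0
    show ?case by (simp only: funpow_0 \<phi>)
  next
    case (Suc n)
    have "circuit_op N ws ((W ^^ n) \<phi>) (\<beta>(q := v)) = circuit_op N ws ((W ^^ n) \<phi>) \<beta>"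
      by (rule circuit_op_indep[of ws q "(W ^^ n) \<phi>" v, OF ws Suc.IH])
    then show ?case by (simp only: W_def funpow.simps comp_apply)
  qed
  have indep: "poly_op p W \<phi> (\<beta>(q := v)) = poly_op p W \<phi> \<beta>" for p \<beta> v
    by (simp only: poly_op_def pow)
  have step: "circuit_op N (if Rs = [] then [] else ctrl [(q, False)] ws)
      (\<lambda>\<beta>. if \<beta> q then poly_op Q W \<phi> \<beta> else poly_op P W \<phi> \<beta>)
    = (\<lambda>\<beta>. if \<beta> q then poly_op Q W \<phi> \<beta> else poly_op P' W \<phi> \<beta>)" (is "?l = ?r")
  proof (cases "Rs = []")
    case True
    then have "P' = P" by (simp add: P'_def)
    then show ?thesis unfolding \<open>P' = P\<close> using True by simp
  next
    case False
    show ?thesis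
    proof
      fix \<beta>
      have "?l \<beta> = (if controls [(q, False)] \<beta> then circuit_op N ws
          (\<lambda>\<beta>. if \<beta> q then poly_op Q W \<phi> \<beta> else poly_op P W \<phi> \<beta>) \<beta>
        else (if \<beta> q then poly_op Q W \<phi> \<beta> else poly_op P W \<phi> \<beta>))"
        unfolding if_not_P[OF False] by (rule circuit_op_ctrl) (use ws in auto)
      moreover have "circuit_op N ws
          (\<lambda>\<beta>. if \<beta> q then poly_op Q W \<phi> \<beta> else poly_op P W \<phi> \<beta>) \<beta> = W (poly_op P W \<phi>) \<beta>"
        if "\<not> \<beta> q"
        unfolding W_def by (rule circuit_op_local[of ws "{q}"]) (use ws that in auto)
      ultimately show "?l \<beta> = ?r \<beta>"
        using False by (auto simp: controls_def P'_def poly_op_pCons_0[OF W])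
    qed
  qed
  have "circuit_op N (gqsp_circuit q ws (R # Rs)) (\<lambda>\<beta>. if \<beta> q then 0 else \<phi> \<beta>)
    = gate_op N ([], U1 q R) (\<lambda>\<beta>. if \<beta> q then poly_op Q W \<phi> \<beta> else poly_op P' W \<phi> \<beta>)"
    unfolding gqsp_circuit.simps circuit_op_append Cons.IH PQ fst_conv snd_conv step by simp
  also have "\<dots> = (\<lambda>\<beta>. R (of_bool (\<beta> q)) 0 * poly_op P' W \<phi> \<beta> + R (of_bool (\<beta> q)) 1 * poly_op Q W \<phi> \<beta>)"
    by (rule ext) (simp add: gate_op_def indep)
  also have "\<dots> = (\<lambda>\<beta>. if \<beta> q then poly_op (snd (gqsp (R # Rs))) W \<phi> \<beta>
      else poly_op (fst (gqsp (R # Rs))) W \<phi> \<beta>)"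
    by (rule ext) (simp add: PQ P'_def[symmetric] poly_op_add poly_op_smult)
  finally show ?case .
qed

section \<open>Linear combination of Pauli strings: select and reflect\<close>

lemma sum_lessThan_2pow_Suc:
  fixes f :: "nat \<Rightarrow> complex"
  shows "(\<Sum>x<2 ^ Suc n. f x) = (\<Sum>x<2 ^ n. f x + f (x + 2 ^ n))"
proof -
  have "{..<2 ^ Suc n} = {..<2 ^ n} \<union> (\<lambda>x. x + 2 ^ n) ` {..<(2::nat) ^ n}"
  proof (intro equalityI subsetI)
    fix x :: nat assume "x \<in> {..<2 ^ Suc n}"
    then have "x < 2 ^ n \<or> x - 2 ^ n < 2 ^ n \<and> x = (x - 2 ^ n) + 2 ^ n" by auto
    then show "x \<in> {..<2 ^ n} \<union> (\<lambda>x. x + 2 ^ n) ` {..<2 ^ n}" by blast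
  qed auto
  then have "(\<Sum>x<2 ^ Suc n. f x) = (\<Sum>x<2 ^ n. f x) + sum f ((\<lambda>x. x + 2 ^ n) ` {..<2 ^ n})"
    by (simp only:) (rule sum.union_disjoint, auto)
  then show ?thesis by (simp add: sum.reindex sum.distrib)
qed

lemma bits_combine:
  assumes "s < 2 ^ m"
  shows "bits (x * 2 ^ m + s) j = (if j < m then bits s j else bits x (j - m))"
proof (cases "j < m")
  case True
  then have "m = (m - Suc j) + 1 + j" by simp
  then have "(2::nat) ^ m = 2 ^ ((m - Suc j) + 1 + j)" by (rule arg_cong)
  then have "x * 2 ^ m + s = s + (x * 2 ^ (m - Suc j) * 2) * 2 ^ j" unfolding power_add by simp
  then have "(x * 2 ^ m + s) div 2 ^ j = s div 2 ^ j + (x * 2 ^ (m - Suc j)) * 2"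
    by (simp only:) simp
  then have "(x * 2 ^ m + s) div 2 ^ j mod 2 = s div 2 ^ j mod 2"
    by (simp only: mod_mult_self1)
  then show ?thesis using True by (simp add: bits_def bitn_def)
next
  case False
  then have "(2::nat) ^ j = 2 ^ m * 2 ^ (j - m)" by (simp flip: power_add)
  then have "(x * 2 ^ m + s) div 2 ^ j = x div 2 ^ (j - m)"
    using assms by (simp add: div_mult2_eq)
  then show ?thesis using False by (simp add: bits_def bitn_def)
qed

lemma bits_add_2pow:
  assumes "x < 2 ^ n"
  shows "j < n \<Longrightarrow> bits (x + 2 ^ n) j = bits x j" and "bits (x + 2 ^ n) n" and "\<not> bits x n"
proof -
  have "bits (x + 2 ^ n) j = (if j < n then bits x j else bits 1 (j - n))" for j
    using bits_combine[OF assms, of 1 j] by (simp add: add.commute)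
  then show "j < n \<Longrightarrow> bits (x + 2 ^ n) j = bits x j" "bits (x + 2 ^ n) n"
    by (simp_all add: bits_def bitn_def)
  show "\<not> bits x n" using assms by (simp add: bits_def bitn_def)
qed

definition had :: cmat where
  "had = (\<lambda>i j. if i = 1 \<and> j = 1 then - complex_of_real (1 / sqrt 2) else complex_of_real (1 / sqrt 2))"

lemma inverse_sqrt2_sq: "complex_of_real (1 / sqrt 2) * complex_of_real (1 / sqrt 2) = 1 / 2"
  by (simp flip: of_real_mult)

lemma inverse_sqrt2_mult: "complex_of_real (1 / sqrt 2) * (complex_of_real (1 / sqrt 2) * z) = z / 2"
  by (simp only: mult.assoc[symmetric] inverse_sqrt2_sq) simp

lemma unitary2_had: "unitary2 had"
  using inverse_sqrt2_sq unfolding unitary2_def less_2_iff sum_less_2 by (simp add: had_def mid_def)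

text \<open>A real symmetric matrix, for |x| at most 1 a reflection, whose top-left entry is x:
  started and projected at 0, the qubit contributes exactly the coefficient x, sign
  included.\<close>

definition coef_refl :: "real \<Rightarrow> cmat" where
  "coef_refl x = (\<lambda>i j. complex_of_real (if i = j then (if i = 0 then x else - x) else sqrt (1 - x\<^sup>2)))"

lemma unitary2_coef_refl:
  assumes "\<bar>x\<bar> \<le> 1" shows "unitary2 (coef_refl x)"
proof -
  have "x * x \<le> 1" using assms by (simp add: abs_square_le_1 flip: power2_eq_square)
  then show ?thesis
    unfolding unitary2_def less_2_iff sum_less_2
    by (auto simp: coef_refl_def mid_def power2_eq_square simp flip: of_real_mult of_real_add)
qed

text \<open>The factors of a term act on different qubits. Commuting involutions have an involution
  as product, which is what makes each term self-inverse.\<close>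

lemma pauli_op_U1_commute:
  assumes "pstr_supp P \<subseteq> {..<m}" "m \<le> b" "m \<le> N"
  shows "pauli_op N P (base_op N (U1 b U) \<psi>) = base_op N (U1 b U) (pauli_op N P \<psi>)"
proof
  fix \<beta>
  have fl: "pstr_flip P (\<beta>(b := v)) = (pstr_flip P \<beta>)(b := v)" for v
    using pstr_flip_outside[OF assms(1), of b "\<beta>(b := v)"] assms(2)
    by (auto simp: pstr_flip_def fun_eq_iff)
  have b: "pstr_flip P \<beta> b = \<beta> b" using pstr_flip_outside[OF assms(1), of b \<beta>] assms(2) by simp
  have ph: "pstr_phase N P (\<beta>(b := v)) = pstr_phase N P \<beta>" for v
    unfolding pstr_phase_mono[OF assms(1,3)] by (rule pstr_phase_cong) (use assms(2) in auto)
  show "pauli_op N P (base_op N (U1 b U) \<psi>) \<beta> = base_op N (U1 b U) (pauli_op N P \<psi>) \<beta>"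
    unfolding pauli_op_def base_op.simps fl b ph by (simp only: distrib_left mult_ac)
qed

text \<open>Layout: system qubits below m, index register from m to m + a - 1, coefficient qubit m +
  a, signal qubit m + a + 1. The conditions can be imposed for every j because the families are
  padded with coefficient 0 and the identity string.\<close>

locale lcu =
  fixes m a N :: nat and \<kappa> :: "nat \<Rightarrow> real" and P :: "nat \<Rightarrow> pstring"
  assumes N: "N = m + a + 2" and \<kappa>: "\<And>j. \<bar>\<kappa> j\<bar> \<le> 1" and supp_P: "\<And>j. pstr_supp (P j) \<subseteq> {..<m}"
begin

abbreviation "b \<equiv> m + a"

lemma m_le_N: "m \<le> N" by (simp add: N)

definition pattern :: "nat \<Rightarrow> (nat \<Rightarrow> bool) \<Rightarrow> bool" where
  "pattern j \<beta> \<longleftrightarrow> (\<forall>i<a. \<beta> (m + i) = bits j i)"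

definition index_controls :: "nat \<Rightarrow> (nat \<times> bool) list" where
  "index_controls j = map (\<lambda>i. (m + i, bits j i)) [0..<a]"

definition term_gates :: "nat \<Rightarrow> gate list" where
  "term_gates j = [([], U1 b (coef_refl (\<kappa> j))), ([], PStr (P j))]"

definition select_list :: "nat list \<Rightarrow> gate list" where
  "select_list js = concat (map (\<lambda>j. ctrl (index_controls j) (term_gates j)) js)"

definition select :: "gate list" where
  "select = select_list [0..<2 ^ a]"

lemma controls_index: "controls (index_controls j) \<beta> \<longleftrightarrow> pattern j \<beta>"
  by (auto simp: controls_def index_controls_def pattern_def)

lemma fst_index_controls: "fst ` set (index_controls j) = (\<lambda>i. m + i) ` {..<a}"
  by (auto simp: index_controls_def image_image lessThan_atLeast0)

lemma pattern_unique:
  assumes "pattern j \<beta>" "pattern j' \<beta>" "j < 2 ^ a" "j' < 2 ^ a" shows "j = j'"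
proof -
  have "bits j = bits j'"
    using assms bits_less[OF assms(3)] bits_less[OF assms(4)]
    by (auto simp: pattern_def assignments_def fun_eq_iff) (metis not_less)+
  then show ?thesis
    using bij_betw_bits[of a] assms(3,4) by (auto simp: bij_betw_def inj_on_def)
qed

lemma pattern_exists: "\<exists>j<2 ^ a. pattern j \<beta>"
proof -
  have "(\<lambda>i. i < a \<and> \<beta> (m + i)) \<in> assignments a" by (auto simp: assignments_def)
  then have "(\<lambda>i. i < a \<and> \<beta> (m + i)) \<in> bits ` {..<2 ^ a}"
    using bij_betw_imp_surj_on[OF bij_betw_bits[of a]] by simp
  then obtain j where "j < 2 ^ a" "bits j = (\<lambda>i. i < a \<and> \<beta> (m + i))" by auto
  then show ?thesis by (auto simp: pattern_def)
qed

lemma term_supp: "g \<in> set (term_gates j) \<Longrightarrow> base_supp (snd g) \<inter> (\<lambda>i. m + i) ` {..<a} = {}"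
  using supp_P[of j] by (auto simp: term_gates_def)

lemma term_local:
  assumes "pattern j \<beta>" "\<And>\<beta>'. pattern j \<beta>' \<Longrightarrow> \<psi> \<beta>' = \<psi>' \<beta>'"
  shows "circuit_op N (term_gates j) \<psi> \<beta> = circuit_op N (term_gates j) \<psi>' \<beta>"
proof (rule circuit_op_local)
  show "base_supp (snd g) \<inter> (\<lambda>i. m + i) ` {..<a} = {}" if "g \<in> set (term_gates j)" for g
    by (rule term_supp[OF that])
  show "\<psi> \<beta>' = \<psi>' \<beta>'" if "\<forall>j\<in>(\<lambda>i. m + i) ` {..<a}. \<beta>' j = \<beta> j" for \<beta>'
    by (rule assms(2)) (use assms(1) that in \<open>auto simp: pattern_def\<close>)
qed

text \<open>Every assignment matches exactly one index value below \<open>2 ^ a\<close>. On the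
  branch of j all other factors act trivially, and the factor of j stays within the branch.\<close>

lemma select_list_op:
  assumes "pattern j \<beta>" "j < 2 ^ a" "distinct js" "set js \<subseteq> {..<2 ^ a}"
  shows "circuit_op N (select_list js) \<psi> \<beta> =
    (if j \<in> set js then circuit_op N (term_gates j) \<psi> \<beta> else \<psi> \<beta>)"
  using assms(3,4)
proof (induction js arbitrary: \<psi>)
  case Nil
  then show ?case by (simp add: select_list_def)
next
  case (Cons i js)
  define \<psi>' where "\<psi>' = circuit_op N (ctrl (index_controls i) (term_gates i)) \<psi>"
  have \<psi>': "\<psi>' \<beta>' = (if pattern i \<beta>' then circuit_op N (term_gates i) \<psi> \<beta>' else \<psi> \<beta>')" for \<beta>'
    unfolding \<psi>'_def controls_index[symmetric]
    by (rule circuit_op_ctrl) (unfold fst_index_controls, rule term_supp)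
  have "circuit_op N (select_list (i # js)) \<psi> \<beta> = circuit_op N (select_list js) \<psi>' \<beta>"
    by (simp add: select_list_def \<psi>'_def)
  also have "\<dots> = (if j \<in> set js then circuit_op N (term_gates j) \<psi>' \<beta> else \<psi>' \<beta>)"
    using Cons by simp
  also have "\<dots> = (if j \<in> set (i # js) then circuit_op N (term_gates j) \<psi> \<beta> else \<psi> \<beta>)"
  proof (cases "j = i")
    case True
    then show ?thesis using Cons.prems \<psi>'[of \<beta>] assms(1) by auto
  next
    case False
    have "\<psi>' \<beta>' = \<psi> \<beta>'" if "pattern j \<beta>'" for \<beta>'
      using pattern_unique[OF that, of i] False assms(2) Cons.prems \<psi>'[of \<beta>'] by auto
    then show ?thesis using False term_local[OF assms(1), of \<psi>' \<psi>] assms(1) by auto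
  qed
  finally show ?case .
qed

lemma select_op:
  assumes "pattern j \<beta>" "j < 2 ^ a"
  shows "circuit_op N select \<psi> \<beta> = circuit_op N (term_gates j) \<psi> \<beta>"
  using select_list_op[OF assms, of "[0..<2 ^ a]" \<psi>] assms(2) by (simp add: select_def lessThan_atLeast0)

lemma term_op: "circuit_op N (term_gates j) \<psi> =
    pauli_op N (P j) (base_op N (U1 b (coef_refl (\<kappa> j))) \<psi>)"
  by (simp add: term_gates_def gate_op_def)

lemma coef_refl_involution:
  assumes "\<bar>x\<bar> \<le> 1" shows "base_op N (U1 b (coef_refl x)) (base_op N (U1 b (coef_refl x)) \<psi>) = \<psi>"
proof
  fix \<beta> :: "nat \<Rightarrow> bool"
  define X S where "X = complex_of_real x" and "S = complex_of_real (sqrt (1 - x\<^sup>2))"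
  have entries: "coef_refl x 0 0 = X" "coef_refl x 0 1 = S" "coef_refl x 1 0 = S" "coef_refl x 1 1 = - X"
    by (simp_all add: coef_refl_def X_def S_def)
  have "S * S = complex_of_real (1 - x\<^sup>2)"
    using assms by (simp add: S_def abs_square_le_1 flip: of_real_mult)
  then have "X * X + S * S = 1" by (simp add: X_def power2_eq_square)
  then have e: "(X * X + S * S) * z = z" for z by simp
  have "S * (X * y + S * z) + - X * (S * y + - X * z) = (X * X + S * S) * z"
    "X * (X * y + S * z) + S * (S * y + - X * z) = (X * X + S * S) * y" for y z
    by (simp_all add: algebra_simps)
  note e = this[unfolded e]
  show "base_op N (U1 b (coef_refl x)) (base_op N (U1 b (coef_refl x)) \<psi>) \<beta> = \<psi> \<beta>"
  proof (cases "\<beta> b")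
    case True
    then have "\<beta>(b := True) = \<beta>" by (simp add: fun_upd_idem)
    then show ?thesis unfolding base_op.simps
      by (simp only: True fun_upd_same fun_upd_upd of_bool_eq entries e)
  next
    case False
    then have "\<beta>(b := False) = \<beta>" by (simp add: fun_upd_idem)
    then show ?thesis unfolding base_op.simps
      by (simp only: False fun_upd_same fun_upd_upd of_bool_eq entries e)
  qed
qed

lemma term_involution: "circuit_op N (term_gates j) (circuit_op N (term_gates j) \<psi>) = \<psi>"
  unfolding term_op
  pauli_op_U1_commute[OF supp_P le_add1 m_le_N] pauli_op_involution
  by (rule coef_refl_involution[OF \<kappa>])

text \<open>On the branch of index j the circuit is the j-th term, and a term does not alter the
  index; so squaring the circuit squares each term.\<close>

lemma select_involution: "circuit_op N select (circuit_op N select \<psi>) = \<psi>"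
proof
  fix \<beta>
  obtain j where j: "j < 2 ^ a" "pattern j \<beta>" using pattern_exists by blast
  have "circuit_op N select (circuit_op N select \<psi>) \<beta>
    = circuit_op N (term_gates j) (circuit_op N select \<psi>) \<beta>" by (rule select_op[OF j(2,1)])
  also have "\<dots> = circuit_op N (term_gates j) (circuit_op N (term_gates j) \<psi>) \<beta>"
    by (rule term_local[OF j(2)]) (rule select_op[OF _ j(1)])
  finally show "circuit_op N select (circuit_op N select \<psi>) \<beta> = \<psi> \<beta>"
    unfolding term_involution .
qed

section \<open>Reflection about the uniform index state\<close>

definition zero_refl :: "gate list" where
  "zero_refl = [([], U1 b (\<lambda>i j. if i = j then - 1 else 0)),
     (map (\<lambda>i. (m + i, False)) [0..<a], U1 b (\<lambda>i j. if i = j then (if i = 0 then - 1 else 1) else 0))]"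

fun refl_upto :: "nat \<Rightarrow> gate list" where
  "refl_upto 0 = zero_refl"
| "refl_upto (Suc i) = ([], U1 (m + i) had) # refl_upto i @ [([], U1 (m + i) had)]"

definition refl :: "gate list" where "refl = refl_upto a"

definition set_index :: "nat \<Rightarrow> nat \<Rightarrow> (nat \<Rightarrow> bool) \<Rightarrow> nat \<Rightarrow> bool" where
  "set_index x i \<beta> = (\<lambda>j. if m \<le> j \<and> j < m + i then bits x (j - m) else \<beta> j)"

text \<open>The orthogonal projection onto the state in which the first i index qubits are uniform
  and the other index qubits and the coefficient qubit are 0. Averaging over the values of a
  register is the rank-one projection onto its uniform superposition.\<close>

definition proj_upto :: "nat \<Rightarrow> state \<Rightarrow> state" where
  "proj_upto i \<psi> \<beta> = (if \<not> \<beta> b \<and> (\<forall>j. i \<le> j \<and> j < a \<longrightarrow> \<not> \<beta> (m + j))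
     then (\<Sum>x<2 ^ i. \<psi> (set_index x i \<beta>)) / 2 ^ i else 0)"

lemma set_index_Suc:
  assumes "x < 2 ^ i"
  shows "set_index x (Suc i) \<beta> = (set_index x i \<beta>)(m + i := False)"
    and "set_index (x + 2 ^ i) (Suc i) \<beta> = (set_index x i \<beta>)(m + i := True)"
  using bits_add_2pow[OF assms] by (auto simp: set_index_def fun_eq_iff less_Suc_eq)

lemma set_index_upd: "set_index x i (\<beta>(m + i := v)) = (set_index x i \<beta>)(m + i := v)"
  by (auto simp: set_index_def fun_eq_iff)

text \<open>The first gate is the global sign -1; the second restores + exactly when index register
  and coefficient qubit are all 0. The global sign matters, since it decides the sign in the walk
  relation.\<close>

lemma zero_refl_op: "circuit_op N zero_refl \<psi> \<beta> = 2 * proj_upto 0 \<psi> \<beta> - \<psi> \<beta>"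
proof -
  have c: "controls (map (\<lambda>i. (m + i, False)) [0..<a]) \<beta> \<longleftrightarrow> (\<forall>j<a. \<not> \<beta> (m + j))"
    by (auto simp: controls_def)
  have "\<beta>(b := \<beta> b) = \<beta>" by simp
  moreover have "set_index 0 0 \<beta> = \<beta>" by (auto simp: set_index_def)
  ultimately show ?thesis
    by (cases "\<beta> b") (auto simp: zero_refl_def gate_op_def c proj_upto_def)
qed

lemma had_op: "gate_op N ([], U1 q had) \<psi> \<beta> = complex_of_real (1 / sqrt 2) *
    (\<psi> (\<beta>(q := False)) + (if \<beta> q then - 1 else 1) * \<psi> (\<beta>(q := True)))"
  by (simp add: gate_op_def had_def distrib_left)

lemma had_involution: "gate_op N ([], U1 q had) (gate_op N ([], U1 q had) \<psi>) = (\<psi> :: state)"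
proof
  fix \<beta> :: "nat \<Rightarrow> bool"
  have "complex_of_real (1 / sqrt 2) * (2 * complex_of_real (1 / sqrt 2))
      = 2 * (complex_of_real (1 / sqrt 2) * complex_of_real (1 / sqrt 2))"
    by (rule mult.left_commute)
  then have s: "complex_of_real (1 / sqrt 2) * (2 * complex_of_real (1 / sqrt 2)) = 1"
    unfolding inverse_sqrt2_sq by simp
  have "\<beta>(q := \<beta> q) = \<beta>" by simp
  then show "gate_op N ([], U1 q had) (gate_op N ([], U1 q had) \<psi>) \<beta> = \<psi> \<beta>"
    unfolding had_op by (cases "\<beta> q") (simp_all add: distrib_left right_diff_distrib s inverse_sqrt2_mult del: of_real_divide)
qed

lemma zero_refl_involution: "circuit_op N zero_refl (circuit_op N zero_refl \<psi>) = \<psi>"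
proof
  fix \<beta>
  have "set_index 0 0 \<beta> = \<beta>" by (auto simp: set_index_def)
  then show "circuit_op N zero_refl (circuit_op N zero_refl \<psi>) \<beta> = \<psi> \<beta>"
    by (auto simp: zero_refl_op proj_upto_def)
qed

lemma refl_upto_involution: "circuit_op N (refl_upto i) (circuit_op N (refl_upto i) \<psi>) = \<psi>"
  by (induction i arbitrary: \<psi>) (simp_all add: zero_refl_involution had_involution)

text \<open>Conjugating by one more Hadamard turns 0 into the uniform state of that qubit. The inner
  projection vanishes where the qubit is 1, so one Hadamard term drops out, and the two factors 1 /
  sqrt 2 supply the additional 1 / 2 of the longer average.\<close>

lemma refl_upto_op:
  "i \<le> a \<Longrightarrow> circuit_op N (refl_upto i) \<psi> \<beta> = 2 * proj_upto i \<psi> \<beta> - \<psi> \<beta>"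
proof (induction i arbitrary: \<psi> \<beta>)
  case 0
  then show ?case by (simp add: zero_refl_op)
next
  case (Suc i)
  let ?H = "gate_op N ([], U1 (m + i) had)" and ?h = "complex_of_real (1 / sqrt 2)"
  have proj0: "proj_upto i (?H \<psi>) (\<beta>(m + i := True)) = 0"
    using Suc.prems by (auto simp: proj_upto_def)
  let ?cond = "\<not> \<beta> b \<and> (\<forall>j. Suc i \<le> j \<and> j < a \<longrightarrow> \<not> \<beta> (m + j))"
  have cond: "(\<not> (\<beta>(m + i := False)) b \<and> (\<forall>j. i \<le> j \<and> j < a \<longrightarrow> \<not> (\<beta>(m + i := False)) (m + j))) \<longleftrightarrow> ?cond"
    using Suc.prems by (auto simp: Suc_le_eq)
  have "proj_upto i (?H \<psi>) (\<beta>(m + i := False)) = (if ?cond then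
      (\<Sum>x<2 ^ i. ?H \<psi> ((set_index x i \<beta>)(m + i := False))) / 2 ^ i else 0)"
    unfolding proj_upto_def cond set_index_upd ..
  also have "(\<Sum>x<2 ^ i. ?H \<psi> ((set_index x i \<beta>)(m + i := False)))
      = (\<Sum>x<2 ^ i. ?h * (\<psi> (set_index x (Suc i) \<beta>) + \<psi> (set_index (x + 2 ^ i) (Suc i) \<beta>)))"
    by (intro sum.cong refl) (simp add: had_op set_index_Suc del: of_real_divide)
  also have "(if ?cond then (\<Sum>x<2 ^ i. ?h *
        (\<psi> (set_index x (Suc i) \<beta>) + \<psi> (set_index (x + 2 ^ i) (Suc i) \<beta>))) / 2 ^ i else 0)
      = (if ?cond then ?h * (\<Sum>x<2 ^ Suc i. \<psi> (set_index x (Suc i) \<beta>)) / 2 ^ i else 0)"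
    unfolding sum_lessThan_2pow_Suc sum_distrib_left ..
  finally have e: "proj_upto i (?H \<psi>) (\<beta>(m + i := False))
    = (if ?cond then ?h * (\<Sum>x<2 ^ Suc i. \<psi> (set_index x (Suc i) \<beta>)) / 2 ^ i else 0)" .
  have pF: "?h * proj_upto i (?H \<psi>) (\<beta>(m + i := False)) = proj_upto (Suc i) \<psi> \<beta>"
    unfolding e proj_upto_def[of "Suc i"] by (auto simp: inverse_sqrt2_mult simp del: of_real_divide)
  have "circuit_op N (refl_upto i) (?H \<psi>) = (\<lambda>\<beta>. 2 * proj_upto i (?H \<psi>) \<beta> - ?H \<psi> \<beta>)"
    by (rule ext, rule Suc.IH) (use Suc.prems in simp)
  then have "circuit_op N (refl_upto (Suc i)) \<psi> \<beta> = ?H (\<lambda>\<beta>. 2 * proj_upto i (?H \<psi>) \<beta> - ?H \<psi> \<beta>) \<beta>"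
    by simp
  also have "\<dots> = 2 * (?h * proj_upto i (?H \<psi>) (\<beta>(m + i := False))) - ?H (?H \<psi>) \<beta>"
    unfolding had_op[of "m + i" "\<lambda>\<beta>. 2 * proj_upto i (?H \<psi>) \<beta> - ?H \<psi> \<beta>"]
      had_op[of "m + i" "?H \<psi>"] proj0 by (simp add: algebra_simps del: of_real_divide)
  finally show ?case unfolding pF had_involution .
qed

end

section \<open>The quantum walk\<close>

text \<open>System vectors are represented by functions of all bits that ignore every qubit from m
  on, so ancilla amplitudes can be attached by plain multiplication.\<close>

definition sys_only :: "nat \<Rightarrow> state \<Rightarrow> bool" where
  "sys_only m v \<longleftrightarrow> (\<forall>\<beta> \<beta>'. (\<forall>j<m. \<beta> j = \<beta>' j) \<longrightarrow> v \<beta> = v \<beta>')"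

lemma sys_onlyD: "sys_only m v \<Longrightarrow> (\<And>j. j < m \<Longrightarrow> \<beta> j = \<beta>' j) \<Longrightarrow> v \<beta> = v \<beta>'"
  by (auto simp: sys_only_def)

text \<open>\<open>z\<^sup>K p((z + 1/z) / 2)\<close> for the Taylor polynomial \<open>p\<close> of degree \<open>K\<close> of \<open>exp(- i \<tau> x)\<close>.\<close>

definition taylor_poly :: "real \<Rightarrow> nat \<Rightarrow> complex poly" where
  "taylor_poly \<tau> K = (\<Sum>n\<le>K. smult ((- \<i> * complex_of_real \<tau> / 2) ^ n / fact n)
     ((pCons 0 ^^ (K - n)) ([:1, 0, 1:] ^ n)))"

lemma degree_shift: "degree ((pCons 0 ^^ n) p) \<le> degree p + n"
  by (induction n) (auto simp: degree_pCons_eq_if)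

lemma poly_shift: "poly ((pCons 0 ^^ n) p) z = z ^ n * poly (p :: complex poly) z"
  by (induction n) (auto simp: mult.assoc)

lemma degree_taylor_poly: "degree (taylor_poly \<tau> K) \<le> 2 * K"
  unfolding taylor_poly_def
proof (rule degree_sum_le)
  fix n assume n: "n \<in> {..K}"
  have "degree ([:1, 0, 1 :: complex:] ^ n) \<le> 2 * n"
    using degree_power_le[of "[:1, 0, 1 :: complex:]" n] by simp
  then show "degree (smult ((- \<i> * complex_of_real \<tau> / 2) ^ n / fact n)
     ((pCons 0 ^^ (K - n)) ([:1, 0, 1:] ^ n))) \<le> 2 * K"
    using degree_shift[of "K - n" "[:1, 0, 1 :: complex:] ^ n"] n
    by (intro order_trans[OF degree_smult_le]) auto
qed simp

lemma poly_taylor_poly: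
  assumes "cmod z = 1"
  shows "poly (taylor_poly \<tau> K) z =
    z ^ K * (\<Sum>n\<le>K. (- \<i> * complex_of_real \<tau> * complex_of_real (Re z)) ^ n / fact n)"
proof -
  have zz: "z * cnj z = 1" using assms complex_norm_square[of z] by simp
  have re: "2 * complex_of_real (Re z) = z + cnj z" using complex_add_cnj[of z] by simp
  have "1 + z * z = z * cnj z + z * z" by (simp only: zz)
  also have "\<dots> = z * (2 * complex_of_real (Re z))"
    unfolding re by (simp add: algebra_simps)
  finally have sq: "1 + z * z = z * (2 * complex_of_real (Re z))" .
  have "poly (taylor_poly \<tau> K) z =
      (\<Sum>n\<le>K. (- \<i> * complex_of_real \<tau> / 2) ^ n / fact n * (z ^ (K - n) * (1 + z * z) ^ n))"
    by (simp add: taylor_poly_def poly_sum poly_shift poly_power)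
  also have "\<dots> = (\<Sum>n\<le>K. z ^ K * ((- \<i> * complex_of_real \<tau> * complex_of_real (Re z)) ^ n / fact n))"
  proof (intro sum.cong refl)
    fix n assume "n \<in> {..K}"
    then have "z ^ K = z ^ (K - n) * z ^ n" by (simp flip: power_add)
    moreover have "(- \<i> * complex_of_real \<tau> / 2) ^ n * (2 * complex_of_real (Re z)) ^ n
        = (- \<i> * complex_of_real \<tau> * complex_of_real (Re z)) ^ n"
      unfolding power_mult_distrib[symmetric] by (intro arg_cong[of _ _ "\<lambda>x. x ^ n"]) simp
    ultimately show "(- \<i> * complex_of_real \<tau> / 2) ^ n / fact n * (z ^ (K - n) * (1 + z * z) ^ n)
        = z ^ K * ((- \<i> * complex_of_real \<tau> * complex_of_real (Re z)) ^ n / fact n)"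
      unfolding sq power_mult_distrib[of z] by (simp add: field_simps)
  qed
  finally show ?thesis by (simp only: sum_distrib_left)
qed

context lcu
begin

text \<open>The uniform index state with coefficient qubit 0, tensored with v. The signal qubit is
  left free here; its initial value is imposed only where the full circuit is applied.\<close>

definition ket :: "state \<Rightarrow> state" where
  "ket v \<beta> = (if \<beta> b then 0 else complex_of_real (1 / sqrt 2) ^ a * v \<beta>)"

definition ham :: "state \<Rightarrow> state" where
  "ham v \<beta> = (\<Sum>j<2 ^ a. complex_of_real (\<kappa> j) * pauli_op N (P j) v \<beta>) / 2 ^ a"

definition walk :: "gate list" where "walk = select @ refl"
definition unwalk :: "gate list" where "unwalk = refl @ select"

abbreviation "W \<equiv> circuit_op N walk"

lemma linear_W: "linear_op W" by (rule linear_circuit_op)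

lemma unwalk_walk: "circuit_op N unwalk (W \<psi>) = \<psi>"
  unfolding walk_def unwalk_def refl_def circuit_op_append
  by (simp only: refl_upto_involution select_involution)

lemma sys_only_pauli:
  assumes "sys_only m v" shows "sys_only m (pauli_op N (P j) v)"
  unfolding sys_only_def
proof (intro allI impI)
  fix \<beta> \<beta>' :: "nat \<Rightarrow> bool" assume e: "\<forall>j<m. \<beta> j = \<beta>' j"
  have "pstr_phase m (P j) \<beta> = pstr_phase m (P j) \<beta>'" by (rule pstr_phase_cong) (use e in auto)
  moreover have "v (pstr_flip (P j) \<beta>) = v (pstr_flip (P j) \<beta>')"
    by (rule sys_onlyD[OF assms]) (use e in \<open>auto simp: pstr_flip_def\<close>)
  ultimately show "pauli_op N (P j) v \<beta> = pauli_op N (P j) v \<beta>'"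
    unfolding pauli_op_mono[OF supp_P m_le_N] by (simp add: pauli_op_def)
qed

lemma sys_only_ham:
  assumes "sys_only m v" shows "sys_only m (ham v)"
proof -
  have "pauli_op N (P i) v \<beta> = pauli_op N (P i) v \<beta>'" if "\<forall>j<m. \<beta> j = \<beta>' j" for i \<beta> \<beta>'
    using sys_onlyD[OF sys_only_pauli[OF assms]] that by blast
  then show ?thesis unfolding sys_only_def ham_def by (auto intro!: sum.cong)
qed

lemma sys_only_ham_pow: "sys_only m v \<Longrightarrow> sys_only m ((ham ^^ n) v)"
  by (induction n) (auto intro: sys_only_ham)

lemma sys_only_set_index: "sys_only m v \<Longrightarrow> v (set_index x i \<beta>) = v \<beta>"
  by (rule sys_onlyD) (auto simp: set_index_def)

lemma set_index_b: "set_index x a \<beta> b = \<beta> b"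
  by (simp add: set_index_def)

lemma pattern_set_index: "pattern x (set_index x a \<beta>)"
  by (simp add: pattern_def set_index_def)

lemma refl_op: "circuit_op N refl \<psi> \<beta> =
    2 * (if \<beta> b then 0 else (\<Sum>x<2 ^ a. \<psi> (set_index x a \<beta>)) / 2 ^ a) - \<psi> \<beta>"
  unfolding refl_def refl_upto_op[OF le_refl] proj_upto_def by auto

lemma refl_ket:
  assumes "sys_only m v" shows "circuit_op N refl (ket v) = ket v"
  by (rule ext) (simp add: refl_op ket_def set_index_b sys_only_set_index[OF assms])

lemma select_ket:
  assumes "pattern j \<beta>" "j < 2 ^ a" "\<not> \<beta> b"
  shows "circuit_op N select (ket v) \<beta> =
    complex_of_real (\<kappa> j) * complex_of_real (1 / sqrt 2) ^ a * pauli_op N (P j) v \<beta>"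
proof -
  have f: "\<not> pstr_flip (P j) \<beta> b"
    using pstr_flip_outside[OF supp_P, of b j \<beta>] assms(3) by simp
  then have "(pstr_flip (P j) \<beta>)(b := False) = pstr_flip (P j) \<beta>" by (simp add: fun_upd_idem)
  then show ?thesis
    unfolding select_op[OF assms(1,2)] term_op
    using f by (simp add: pauli_op_def coef_refl_def ket_def)
qed

text \<open>The reflection is 2 \<Pi> - 1, and \<Pi> maps the selected state to
  \<open>ket (ham v)\<close>: the part with coefficient qubit 1 is projected away, and the average
  over the index is the average of the terms.\<close>

lemma refl_select_ket:
  assumes "sys_only m v"
  shows "W (ket v) \<beta> = 2 * ket (ham v) \<beta> - circuit_op N select (ket v) \<beta>"
proof (cases "\<beta> b")
  case True
  then show ?thesis by (simp add: walk_def refl_op ket_def)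
next
  case False
  have "(\<Sum>x<2 ^ a. circuit_op N select (ket v) (set_index x a \<beta>))
      = (\<Sum>x<2 ^ a. complex_of_real (\<kappa> x) * complex_of_real (1 / sqrt 2) ^ a * pauli_op N (P x) v \<beta>)"
  proof (intro sum.cong refl)
    fix x assume "x \<in> {..<(2::nat) ^ a}"
    then show "circuit_op N select (ket v) (set_index x a \<beta>) =
      complex_of_real (\<kappa> x) * complex_of_real (1 / sqrt 2) ^ a * pauli_op N (P x) v \<beta>"
      using False by (simp add: select_ket[OF pattern_set_index] set_index_b
          sys_only_set_index[OF sys_only_pauli[OF assms]] del: of_real_divide)
  qed
  also have "\<dots> = complex_of_real (1 / sqrt 2) ^ a *
      (\<Sum>x<2 ^ a. complex_of_real (\<kappa> x) * pauli_op N (P x) v \<beta>)"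
    unfolding sum_distrib_left by (simp only: mult_ac)
  finally show ?thesis using False by (simp add: walk_def refl_op ket_def ham_def del: of_real_divide)
qed

text \<open>On the range of \<open>ket\<close> the walk satisfies \<open>W\<^sup>2 + 1 = 2 W H\<close>, so that
  \<open>(W + W\<^sup>-\<^sup>1) / 2\<close> acts there as the encoded Hamiltonian.\<close>

lemma walk_walk_ket:
  assumes "sys_only m v"
  shows "W (W (ket v)) = (\<lambda>\<beta>. 2 * W (ket (ham v)) \<beta> - ket v \<beta>)"
proof -
  have "W (ket v) = (\<lambda>\<beta>. 2 * ket (ham v) \<beta> + (- 1) * circuit_op N select (ket v) \<beta>)"
    by (rule ext) (simp add: refl_select_ket[OF assms])
  then have "W (W (ket v)) = W (\<lambda>\<beta>. 2 * ket (ham v) \<beta> + (- 1) * circuit_op N select (ket v) \<beta>)"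
    by simp
  also have "\<dots> = (\<lambda>\<beta>. W (\<lambda>\<beta>. 2 * ket (ham v) \<beta>) \<beta> + (- 1) * W (circuit_op N select (ket v)) \<beta>)"
    by (rule linear_opD[OF linear_W])
  also have "W (\<lambda>\<beta>. 2 * ket (ham v) \<beta>) = (\<lambda>\<beta>. 2 * W (ket (ham v)) \<beta>)"
    by (rule linear_op_scale[OF linear_W])
  also have "W (circuit_op N select (ket v)) = ket v"
    by (simp add: walk_def select_involution refl_ket[OF assms])
  finally show ?thesis by simp
qed

text \<open>The operator form of (1 + z^2)^n = z^n (z + 1/z)^n. Each factor yields one W and one
  doubled \<open>ham\<close>. The walk relation is available only on vectors \<open>ket u\<close>,
  so the powers of W collected so far are first commuted to the outside.\<close>

lemma poly_op_walk:
  assumes "sys_only m v"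
  shows "poly_op ([:1, 0, 1:] ^ n) W (ket v) = (\<lambda>\<beta>. 2 ^ n * (W ^^ n) (ket ((ham ^^ n) v)) \<beta>)"
proof (induction n)
  case 0
  show ?case by simp
next
  case (Suc n)
  define u where "u = (ham ^^ n) v"
  define \<phi> where "\<phi> = poly_op ([:1, 0, 1:] ^ n) W (ket v)"
  have u: "sys_only m u" unfolding u_def by (rule sys_only_ham_pow[OF assms])
  have lin: "linear_op (W ^^ n)" by (rule linear_op_funpow[OF linear_W])
  have "[:1, 0, 1:] ^ Suc n = [:1, 0, 1:] ^ n + pCons 0 (pCons 0 ([:1, 0, 1 :: complex:] ^ n))"
    by simp
  then have "poly_op ([:1, 0, 1:] ^ Suc n) W (ket v) = (\<lambda>\<beta>. \<phi> \<beta> + W (W \<phi>) \<beta>)"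
    by (simp only: poly_op_add poly_op_pCons_0[OF linear_W] \<phi>_def)
  also have "W (W \<phi>) = (\<lambda>\<beta>. 2 ^ n * (W ^^ n) (W (W (ket u))) \<beta>)"
  proof -
    have "W (W \<phi>) = (\<lambda>\<beta>. 2 ^ n * W (W ((W ^^ n) (ket u))) \<beta>)"
      unfolding \<phi>_def Suc.IH u_def[symmetric] linear_op_scale[OF linear_W] ..
    moreover have "W (W ((W ^^ n) (ket u))) = (W ^^ n) (W (W (ket u)))"
      by (simp only: funpow_swap1)
    ultimately show ?thesis by (simp only:)
  qed
  also have "(W ^^ n) (W (W (ket u))) = (\<lambda>\<beta>. 2 * (W ^^ n) (W (ket (ham u))) \<beta> + (- 1) * (W ^^ n) (ket u) \<beta>)"
    unfolding walk_walk_ket[OF u]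
    using linear_opD[OF lin, of "\<lambda>\<beta>. 2 * W (ket (ham u)) \<beta>" "-1" "ket u"]
    by (simp add: linear_op_scale[OF lin])
  also have "\<phi> = (\<lambda>\<beta>. 2 ^ n * (W ^^ n) (ket u) \<beta>)"
    unfolding \<phi>_def Suc.IH u_def ..
  also have "(W ^^ n) (W (ket (ham u))) = (W ^^ Suc n) (ket ((ham ^^ Suc n) v))"
    by (simp add: u_def funpow_swap1)
  finally show ?case by (simp add: algebra_simps)
qed

definition taylor_ham :: "real \<Rightarrow> nat \<Rightarrow> state \<Rightarrow> state" where
  "taylor_ham \<tau> K v \<beta> = (\<Sum>n\<le>K. (- \<i> * complex_of_real \<tau>) ^ n / fact n * (ham ^^ n) v \<beta>)"

text \<open>The shift by K - n brings every term to the common power W^K, which leaves the sum by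
  linearity and can be undone by inverse walks.\<close>

lemma poly_op_taylor:
  assumes "sys_only m v"
  shows "poly_op (taylor_poly \<tau> K) W (ket v) = (W ^^ K) (ket (taylor_ham \<tau> K v))"
proof -
  have "poly_op (taylor_poly \<tau> K) W (ket v) = (\<lambda>\<beta>. \<Sum>n\<le>K. (- \<i> * complex_of_real \<tau> / 2) ^ n / fact n *
      (W ^^ (K - n)) (poly_op ([:1, 0, 1:] ^ n) W (ket v)) \<beta>)"
    unfolding taylor_poly_def
    by (simp only: poly_op_sum[OF finite_atMost] poly_op_smult poly_op_shift[OF linear_W])
  also have "\<dots> = (\<lambda>\<beta>. \<Sum>n\<le>K. (- \<i> * complex_of_real \<tau>) ^ n / fact n * (W ^^ K) (ket ((ham ^^ n) v)) \<beta>)"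
  proof (intro ext sum.cong refl)
    fix \<beta> n assume n: "n \<in> {..K}"
    have "(W ^^ (K - n)) (poly_op ([:1, 0, 1:] ^ n) W (ket v))
      = (\<lambda>\<beta>. 2 ^ n * (W ^^ (K - n)) ((W ^^ n) (ket ((ham ^^ n) v))) \<beta>)"
      unfolding poly_op_walk[OF assms] by (rule linear_op_scale[OF linear_op_funpow[OF linear_W]])
    moreover have "(W ^^ (K - n)) ((W ^^ n) \<psi>) = (W ^^ K) \<psi>" for \<psi>
      using n funpow_add[of "K - n" n W] by simp
    moreover have "(- \<i> * complex_of_real \<tau> / 2) ^ n * 2 ^ n = (- \<i> * complex_of_real \<tau>) ^ n"
      unfolding power_mult_distrib[symmetric] by simp
    ultimately show "(- \<i> * complex_of_real \<tau> / 2) ^ n / fact n *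
        (W ^^ (K - n)) (poly_op ([:1, 0, 1:] ^ n) W (ket v)) \<beta>
      = (- \<i> * complex_of_real \<tau>) ^ n / fact n * (W ^^ K) (ket ((ham ^^ n) v)) \<beta>"
      by (simp add: mult.assoc[symmetric])
  qed
  also have "\<dots> = (W ^^ K) (\<lambda>\<beta>. \<Sum>n\<le>K. (- \<i> * complex_of_real \<tau>) ^ n / fact n * ket ((ham ^^ n) v) \<beta>)"
    by (rule linear_op_sum[OF linear_op_funpow[OF linear_W], symmetric]) simp
  also have "(\<lambda>\<beta>. \<Sum>n\<le>K. (- \<i> * complex_of_real \<tau>) ^ n / fact n * ket ((ham ^^ n) v) \<beta>)
      = ket (taylor_ham \<tau> K v)"
    by (rule ext) (simp add: ket_def taylor_ham_def sum_distrib_left mult.left_commute del: of_real_divide)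
  finally show ?thesis .
qed

section \<open>The full circuit and the validity of its gates\<close>

definition unwalks :: "nat \<Rightarrow> gate list" where
  "unwalks K = concat (replicate K unwalk)"

lemma unwalks_walks: "circuit_op N (unwalks K) ((W ^^ K) \<psi>) = \<psi>"
  by (induction K) (simp_all add: unwalks_def unwalk_walk)

abbreviation "q \<equiv> m + a + 1"

text \<open>Besides validity this records that the signal qubit is not touched, as is required for
  adding it as a control.\<close>

definition walk_gate :: "gate \<Rightarrow> bool" where
  "walk_gate g \<longleftrightarrow> base_supp (snd g) \<subseteq> {..b} \<and> fst ` set (fst g) \<subseteq> {..<b} \<and> gate_ok N g"

lemma walk_gate_refl: "i \<le> a \<Longrightarrow> g \<in> set (refl_upto i) \<Longrightarrow> walk_gate g"
proof (induction i)
  case 0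
  then show ?case
    unfolding walk_gate_def gate_ok_def unfolding N
    by (auto simp: zero_refl_def unitary2_def less_2_iff sum_less_2 mid_def
        comp_def distinct_map inj_on_def)
next
  case (Suc i)
  have "walk_gate ([], U1 (m + i) had)"
    using Suc.prems(1) unfolding walk_gate_def gate_ok_def unfolding N by (simp add: unitary2_had)
  then show ?case using Suc by auto
qed

lemma walk_gate_select:
  assumes "g \<in> set select" shows "walk_gate g"
proof -
  obtain j h where h: "h \<in> set (term_gates j)" "g = (index_controls j @ fst h, snd h)"
    using assms by (auto simp: select_def select_list_def ctrl_def)
  have d: "distinct (map fst (index_controls j))"
    by (simp add: index_controls_def comp_def distinct_map inj_on_def)
  have f: "fst ` set (index_controls j) = (\<lambda>i. m + i) ` {..<a}" by (rule fst_index_controls)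
  have i: "x < b" if "(x, y) \<in> set (index_controls j)" for x y
    using that by (auto simp: index_controls_def)
  show ?thesis
    using h(1) supp_P[of j] d unfolding h(2) gate_ok_def walk_gate_def unfolding N
    by (auto simp: term_gates_def f unitary2_coef_refl[OF \<kappa>] dest: i)
qed

lemma walk_gate_walk: "g \<in> set walk \<Longrightarrow> walk_gate g"
  using walk_gate_select walk_gate_refl[OF le_refl] unfolding walk_def refl_def by (metis Un_iff set_append)

lemma unwalks_subset: "g \<in> set (unwalks K) \<Longrightarrow> g \<in> set walk"
  by (induction K) (auto simp: unwalks_def walk_def unwalk_def)

lemma walk_not_q:
  assumes "g \<in> set walk" shows "q \<notin> base_supp (snd g) \<and> q \<notin> fst ` set (fst g)"
proof -
  have "q \<notin> {..b}" "q \<notin> {..<b}" by auto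
  then show ?thesis using walk_gate_walk[OF assms] unfolding walk_gate_def by blast
qed

definition qsp_circuit :: "cmat list \<Rightarrow> nat \<Rightarrow> gate list" where
  "qsp_circuit Rs K = gqsp_circuit q walk Rs @ unwalks K"

lemma gqsp_circuit_ok:
  "\<forall>R\<in>set Rs. unitary2 R \<Longrightarrow> g \<in> set (gqsp_circuit q walk Rs) \<Longrightarrow> gate_ok N g"
proof (induction Rs)
  case Nil
  then show ?case by simp
next
  case (Cons R Rs)
  have "gate_ok N g" if "g \<in> set (ctrl [(q, False)] walk)"
  proof -
    have "g \<in> (\<lambda>h. ((q, False) # fst h, snd h)) ` set walk" using that by (simp add: ctrl_def)
    then obtain h where h: "g = ((q, False) # fst h, snd h)" "h \<in> set walk" by (rule imageE)
    show ?thesis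
      using walk_not_q[OF h(2)] walk_gate_walk[OF h(2)] 
      unfolding walk_gate_def gate_ok_def h(1) unfolding N by auto
  qed
  moreover have "gate_ok N ([], U1 q R)" using Cons.prems(1) unfolding gate_ok_def N by simp
  ultimately show ?case using Cons by (auto split: if_splits)
qed

lemma qsp_circuit_ok:
  assumes "\<forall>R\<in>set Rs. unitary2 R" "g \<in> set (qsp_circuit Rs K)" shows "gate_ok N g"
proof (cases "g \<in> set (unwalks K)")
  case True
  then show ?thesis using walk_gate_walk[OF unwalks_subset[OF True]] by (simp add: walk_gate_def)
next
  case False
  then have "g \<in> set (gqsp_circuit q walk Rs)" using assms(2) unfolding qsp_circuit_def by simp
  then show ?thesis by (rule gqsp_circuit_ok[OF assms(1)])
qed

text \<open>Only the branch with signal qubit 0 is described; the other one carries the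
  complementary polynomial and is orthogonal to the ancilla state. The inverse walks do not touch
  that qubit, so they can be evaluated inside the branch, where they cancel W^K.\<close>

lemma qsp_circuit_op:
  assumes v: "sys_only m v" and Rs: "gqsp Rs = (smult c (taylor_poly \<tau> K), Q)" and \<beta>: "\<not> \<beta> q"
  shows "circuit_op N (qsp_circuit Rs K) (\<lambda>\<beta>. if \<beta> q then 0 else ket v \<beta>) \<beta> = c * ket (taylor_ham \<tau> K v) \<beta>"
proof -
  have ind: "ket v (\<beta>(q := x)) = ket v \<beta>" for \<beta> x
    using sys_onlyD[OF v, of "\<beta>(q := x)" \<beta>] by (simp add: ket_def)
  have "circuit_op N (qsp_circuit Rs K) (\<lambda>\<beta>. if \<beta> q then 0 else ket v \<beta>) \<beta>
    = circuit_op N (unwalks K) (\<lambda>\<beta>. if \<beta> q then poly_op Q W (ket v) \<beta>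
        else poly_op (smult c (taylor_poly \<tau> K)) W (ket v) \<beta>) \<beta>"
    using circuit_op_gqsp[of walk q "ket v" N Rs, OF walk_not_q ind]
    by (simp only: qsp_circuit_def circuit_op_append Rs fst_conv snd_conv)
  also have "\<dots> = circuit_op N (unwalks K) (poly_op (smult c (taylor_poly \<tau> K)) W (ket v)) \<beta>"
  proof (rule circuit_op_local[of _ "{q}"])
    show "base_supp (snd g) \<inter> {q} = {}" if "g \<in> set (unwalks K)" for g
      using walk_not_q[OF unwalks_subset[OF that]] by blast
  qed (use \<beta> in auto)
  also have "poly_op (smult c (taylor_poly \<tau> K)) W (ket v)
      = (\<lambda>\<beta>. c * (W ^^ K) (ket (taylor_ham \<tau> K v)) \<beta>)"
    unfolding poly_op_smult poly_op_taylor[OF v] ..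
  also have "circuit_op N (unwalks K) \<dots> = (\<lambda>\<beta>. c * ket (taylor_ham \<tau> K v) \<beta>)"
    unfolding linear_op_scale[OF linear_circuit_op] unwalks_walks ..
  finally show ?thesis .
qed

end

section \<open>Norm bounds and the exponential series\<close>

definition mvec :: "nat \<Rightarrow> cmat \<Rightarrow> (nat \<Rightarrow> complex) \<Rightarrow> nat \<Rightarrow> complex" where
  "mvec d A v i = (\<Sum>j<d. A i j * v j)"

lemma vnorm_L2_set: "vnorm d v = L2_set (\<lambda>i. cmod (v i)) {..<d}"
  by (simp add: vnorm_def L2_set_def)

lemma vnorm_cong: "(\<And>i. i < d \<Longrightarrow> u i = v i) \<Longrightarrow> vnorm d u = vnorm d v"
  by (simp add: vnorm_def)

lemma vnorm_nonneg: "0 \<le> vnorm d v"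
  by (simp add: vnorm_L2_set)

lemma vnorm_add_le: "vnorm d (\<lambda>i. u i + v i) \<le> vnorm d u + vnorm d v"
proof -
  have "vnorm d (\<lambda>i. u i + v i) \<le> L2_set (\<lambda>i. cmod (u i) + cmod (v i)) {..<d}"
    unfolding vnorm_L2_set by (rule L2_set_mono) (auto simp: norm_triangle_ineq)
  also have "\<dots> \<le> vnorm d u + vnorm d v"
    unfolding vnorm_L2_set by (rule L2_set_triangle_ineq)
  finally show ?thesis .
qed

lemma vnorm_scale: "vnorm d (\<lambda>i. c * v i) = cmod c * vnorm d v"
  by (simp add: vnorm_def norm_mult power_mult_distrib real_sqrt_mult flip: sum_distrib_left)

lemma vnorm_sum_le:
  assumes "finite I" shows "vnorm d (\<lambda>i. \<Sum>k\<in>I. c k * v k i) \<le> (\<Sum>k\<in>I. cmod (c k) * vnorm d (v k))"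
  using assms
proof (induction I rule: finite_induct)
  case empty
  then show ?case by (simp add: vnorm_def)
next
  case (insert k I)
  then have "vnorm d (\<lambda>i. \<Sum>k\<in>insert k I. c k * v k i)
      = vnorm d (\<lambda>i. c k * v k i + (\<Sum>k\<in>I. c k * v k i))" by simp
  also have "\<dots> \<le> vnorm d (\<lambda>i. c k * v k i) + vnorm d (\<lambda>i. \<Sum>k\<in>I. c k * v k i)"
    by (rule vnorm_add_le)
  also have "\<dots> \<le> cmod (c k) * vnorm d (v k) + (\<Sum>k\<in>I. cmod (c k) * vnorm d (v k))"
    using insert.IH by (simp add: vnorm_scale)
  finally show ?case using insert.hyps by simp
qed

lemma cmod_le_vnorm: "i < d \<Longrightarrow> cmod (v i) \<le> vnorm d v"
  unfolding vnorm_L2_set by (rule member_le_L2_set) auto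

lemma mvec_mmul: "mvec d (mmul d A B) v i = mvec d A (mvec d B v) i"
  unfolding mvec_def mmul_def sum_distrib_left sum_distrib_right mult.assoc by (rule sum.swap)

lemma mvec_mid: "i < d \<Longrightarrow> mvec d mid v i = v i"
  by (simp add: mvec_def mid_def if_distrib[of "\<lambda>x. x * _"] cong: if_cong)

lemma mvec_unit: "j < d \<Longrightarrow> mvec d A (\<lambda>i. if i = j then 1 else 0) i = A i j"
  by (simp add: mvec_def if_distrib cong: if_cong)

lemma vnorm_unit: "j < d \<Longrightarrow> vnorm d (\<lambda>i. if i = j then 1 else 0) = 1"
  by (simp add: vnorm_def if_distrib[of "\<lambda>x. (cmod x)\<^sup>2"] cong: if_cong)

lemma mpow_scale: "mpow d (\<lambda>i j. c * A i j) n = (\<lambda>i j. c ^ n * mpow d A n i j)"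
proof (induction n)
  case 0
  show ?case by simp
next
  case (Suc n)
  show ?case by (simp add: Suc.IH mmul_def sum_distrib_left mult_ac)
qed

definition taylor_mat :: "nat \<Rightarrow> cmat \<Rightarrow> nat \<Rightarrow> cmat" where
  "taylor_mat d A K i j = (\<Sum>n\<le>K. mpow d A n i j / of_nat (fact n))"

text \<open>The exponential is an entrywise series, so a bound on the action of A is needed for its
  convergence as well as for the truncation error.\<close>

locale bounded_mat =
  fixes d :: nat and A :: cmat and \<tau> :: real
  assumes \<tau>: "0 \<le> \<tau>" and bound: "\<And>v. vnorm d (mvec d A v) \<le> \<tau> * vnorm d v"
begin

lemma vnorm_mpow: "vnorm d (mvec d (mpow d A n) v) \<le> \<tau> ^ n * vnorm d v"
proof (induction n)
  case 0
  have "vnorm d (mvec d mid v) = vnorm d v" by (rule vnorm_cong) (rule mvec_mid)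
  then show ?case by simp
next
  case (Suc n)
  have "vnorm d (mvec d (mpow d A (Suc n)) v) = vnorm d (mvec d A (mvec d (mpow d A n) v))"
    by (rule vnorm_cong) (simp add: mvec_mmul)
  also have "\<dots> \<le> \<tau> * vnorm d (mvec d (mpow d A n) v)" by (rule bound)
  also have "\<dots> \<le> \<tau> * (\<tau> ^ n * vnorm d v)" by (rule mult_left_mono[OF Suc.IH \<tau>])
  finally show ?case by (simp add: mult.assoc)
qed

lemma cmod_mpow: "i < d \<Longrightarrow> j < d \<Longrightarrow> cmod (mpow d A n i j) \<le> \<tau> ^ n"
  using cmod_le_vnorm[of i d "mvec d (mpow d A n) (\<lambda>i. if i = j then 1 else 0)"]
    vnorm_mpow[of n "\<lambda>i. if i = j then 1 else 0"]
  by (simp add: mvec_unit vnorm_unit)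

lemma taylor_mat_tendsto_mexp:
  assumes "i < d" "j < d" shows "(\<lambda>K. taylor_mat d A K i j) \<longlonglongrightarrow> mexp d A i j"
proof -
  have "summable (\<lambda>n. \<tau> ^ n /\<^sub>R fact n)" by (rule summable_exp_generic)
  then have "summable (\<lambda>n. mpow d A n i j / of_nat (fact n))"
  proof (rule summable_comparison_test')
    show "norm (mpow d A n i j / of_nat (fact n)) \<le> \<tau> ^ n /\<^sub>R fact n" for n
    proof -
      have "\<tau> ^ n /\<^sub>R fact n = \<tau> ^ n / fact n" by (simp add: divide_inverse mult.commute)
      then show ?thesis using cmod_mpow[OF assms, of n] by (simp add: norm_divide divide_right_mono)
    qed
  qed
  from summable_LIMSEQ'[OF this] show ?thesis
    by (simp only: taylor_mat_def mexp_def)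
qed

text \<open>Two truncations differ on a unit vector by at most a finite piece of the tail. The upper
  degree goes to infinity for a fixed vector, where entrywise convergence suffices; the supremum
  over unit vectors comes last.\<close>

lemma taylor_mat_error:
  assumes d: "d > 0" and T: "\<And>M. (\<Sum>n\<in>{K<..M}. \<tau> ^ n / fact n) \<le> T"
  shows "op_norm d (\<lambda>i j. taylor_mat d A K i j - mexp d A i j) \<le> T"
  unfolding op_norm_def
proof (rule cSup_least)
  have "vnorm d (\<lambda>i. if i = 0 then 1 else 0) = 1" using d by (rule vnorm_unit)
  then show "{vnorm d (\<lambda>i. \<Sum>j<d. (taylor_mat d A K i j - mexp d A i j) * v j) |v. vnorm d v = 1} \<noteq> {}"
    by blast
  fix x assume "x \<in> {vnorm d (\<lambda>i. \<Sum>j<d. (taylor_mat d A K i j - mexp d A i j) * v j) |v. vnorm d v = 1}"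
  then obtain v where v: "vnorm d v = 1"
    and x: "x = vnorm d (\<lambda>i. \<Sum>j<d. (taylor_mat d A K i j - mexp d A i j) * v j)" by blast
  define e where "e M = vnorm d (\<lambda>i. \<Sum>j<d. (taylor_mat d A K i j - taylor_mat d A M i j) * v j)" for M
  have "e \<longlonglongrightarrow> x"
    unfolding e_def x vnorm_def
    by (intro tendsto_intros taylor_mat_tendsto_mexp) auto
  moreover have "e M \<le> T" if "K \<le> M" for M
  proof -
    have split: "taylor_mat d A M i j = taylor_mat d A K i j + (\<Sum>n\<in>{K<..M}. mpow d A n i j / of_nat (fact n))" for i j
    proof -
      have "{..M} = {..K} \<union> {K<..M}" using that by auto
      then show ?thesis unfolding taylor_mat_def by (simp only:) (rule sum.union_disjoint, auto)
    qed
    have "(\<Sum>j<d. (taylor_mat d A K i j - taylor_mat d A M i j) * v j)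
        = (\<Sum>n\<in>{K<..M}. (- 1 / of_nat (fact n)) * mvec d (mpow d A n) v i)" for i
      unfolding split mvec_def sum_distrib_left
      by (subst sum.swap) (simp add: sum_distrib_right sum_negf)
    then have "e M = vnorm d (\<lambda>i. \<Sum>n\<in>{K<..M}. (- 1 / of_nat (fact n)) * mvec d (mpow d A n) v i)"
      by (simp only: e_def)
    also have "\<dots> \<le> (\<Sum>n\<in>{K<..M}. cmod (- 1 / of_nat (fact n)) * vnorm d (mvec d (mpow d A n) v))"
      by (rule vnorm_sum_le) simp
    also have "\<dots> \<le> (\<Sum>n\<in>{K<..M}. \<tau> ^ n / fact n)"
      using vnorm_mpow[of _ v] v by (intro sum_mono) (simp add: norm_divide divide_right_mono)
    finally show ?thesis using T[of M] by linarith
  qed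
  ultimately show "x \<le> T" using LIMSEQ_le_const2[of e x T] by blast
qed

end

text \<open>For n > K the factor exp (n - K) is at least 1; inserting it turns the tail into part of
  exp (- K) times the series of exp (e \<tau>). Hence K = e \<tau> + ln (1 / \<epsilon>), rounded
  up, suffices.\<close>

lemma exp_tail:
  fixes \<tau> :: real assumes "0 \<le> \<tau>"
  shows "(\<Sum>n\<in>{K<..M}. \<tau> ^ n / fact n) \<le> exp (exp 1 * \<tau> - real K)"
proof -
  have "(\<Sum>n\<in>{K<..M}. \<tau> ^ n / fact n) \<le> (\<Sum>n\<in>{K<..M}. exp (- real K) * ((exp 1 * \<tau>) ^ n /\<^sub>R fact n))"
  proof (rule sum_mono)
    fix n assume n: "n \<in> {K<..M}"
    have "1 \<le> exp (real n - real K)" using n by simp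
    also have "\<dots> = exp (- real K) * exp 1 ^ n"
      by (simp add: exp_diff exp_minus field_simps flip: exp_of_nat_mult)
    finally have "1 * (\<tau> ^ n / fact n) \<le> exp (- real K) * exp 1 ^ n * (\<tau> ^ n / fact n)"
      using assms by (intro mult_right_mono) auto
    then show "\<tau> ^ n / fact n \<le> exp (- real K) * ((exp 1 * \<tau>) ^ n /\<^sub>R fact n)"
      by (simp add: power_mult_distrib divide_inverse mult_ac)
  qed
  also have "\<dots> = exp (- real K) * (\<Sum>n\<in>{K<..M}. (exp 1 * \<tau>) ^ n /\<^sub>R fact n)"
    by (simp only: sum_distrib_left)
  also have "\<dots> \<le> exp (- real K) * (\<Sum>n. (exp 1 * \<tau>) ^ n /\<^sub>R fact n)"
    using assms by (intro mult_left_mono sum_le_suminf summable_exp_generic) auto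
  also have "\<dots> = exp (- real K) * exp (exp 1 * \<tau>)" by (simp only: exp_def)
  also have "\<dots> = exp (exp 1 * \<tau> - real K)" by (simp flip: exp_add)
  finally show ?thesis .
qed

text \<open>At K = 0 the general tail bound is at least 1; this one tends to 0 with \<tau>, as the
  comparison with the identity requires.\<close>

lemma exp_tail_0:
  fixes \<tau> :: real assumes "0 \<le> \<tau>"
  shows "(\<Sum>n\<in>{0<..M}. \<tau> ^ n / fact n) \<le> exp \<tau> - 1"
proof -
  have "{..M} = insert 0 {0<..M}" by auto
  then have "1 + (\<Sum>n\<in>{0<..M}. \<tau> ^ n / fact n) = (\<Sum>n\<le>M. \<tau> ^ n / fact n)"
    by (simp only:) simp
  also have "\<dots> = (\<Sum>n\<le>M. \<tau> ^ n /\<^sub>R fact n)"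
    by (simp add: divide_inverse mult.commute)
  also have "\<dots> \<le> exp \<tau>"
    unfolding exp_def using assms by (intro sum_le_suminf summable_exp_generic) auto
  finally show ?thesis by simp
qed

text \<open>The exponential of an imaginary number has modulus one, so the truncated series exceeds
  1 by at most the tail.\<close>

lemma cmod_exp_taylor:
  assumes "0 \<le> \<tau>" "\<bar>x\<bar> \<le> 1"
  shows "cmod (\<Sum>n\<le>K. (- \<i> * complex_of_real \<tau> * complex_of_real x) ^ n / fact n)
    \<le> 1 + exp (exp 1 * \<tau> - real K)"
proof -
  define z where "z = - \<i> * complex_of_real \<tau> * complex_of_real x"
  define f where "f M = (\<Sum>n\<le>M. z ^ n / fact n)" for M
  have z: "cmod z \<le> \<tau>" using assms by (simp add: z_def norm_mult mult_left_le)
  have "exp z = exp (\<i> * complex_of_real (- \<tau> * x))" by (simp add: z_def mult.assoc)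
  then have ez: "cmod (exp z) = 1" by (simp only: norm_exp_i_times)
  have "(\<lambda>M. \<Sum>n\<le>M. z ^ n /\<^sub>R fact n) \<longlonglongrightarrow> exp z"
    unfolding exp_def by (rule summable_LIMSEQ'[OF summable_exp_generic])
  then have lim: "f \<longlonglongrightarrow> exp z"
    unfolding f_def by (simp add: scaleR_conv_of_real divide_inverse mult.commute)
  have "cmod (f K - f M) \<le> exp (exp 1 * \<tau> - real K)" if "K \<le> M" for M
  proof -
    have "{..M} = {..K} \<union> {K<..M}" using that by auto
    then have "f M = f K + (\<Sum>n\<in>{K<..M}. z ^ n / fact n)"
      unfolding f_def by (simp only:) (rule sum.union_disjoint, auto)
    then have "cmod (f K - f M) = cmod (\<Sum>n\<in>{K<..M}. z ^ n / fact n)" by (simp add: norm_minus_commute)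
    also have "\<dots> \<le> (\<Sum>n\<in>{K<..M}. \<tau> ^ n / fact n)"
      by (rule sum_norm_le) (simp add: norm_divide norm_power divide_right_mono power_mono z)
    also have "\<dots> \<le> exp (exp 1 * \<tau> - real K)" by (rule exp_tail[OF assms(1)])
    finally show ?thesis .
  qed
  moreover have "(\<lambda>M. cmod (f K - f M)) \<longlonglongrightarrow> cmod (f K - exp z)"
    by (intro tendsto_intros lim)
  ultimately have "cmod (f K - exp z) \<le> exp (exp 1 * \<tau> - real K)"
    by (rule_tac LIMSEQ_le_const2) blast+
  then have "cmod (f K) \<le> 1 + exp (exp 1 * \<tau> - real K)"
    using norm_triangle_ineq2[of "f K" "exp z"] ez by linarith
  then show ?thesis by (simp only: f_def z_def)
qed

lemma vnorm_pstr_mat: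
  assumes P: "pstr_supp P \<subseteq> {..<m}"
  shows "vnorm (2 ^ m) (mvec (2 ^ m) (pstr_mat m P) v) = vnorm (2 ^ m) v"
proof -
  \<comment> \<open>Carries the vector over to bit assignments, where the string acts as a
    permutation with phases; flips stay inside \<open>assignments m\<close>, so no other value is
    read.\<close>
  define \<psi> where "\<psi> = v \<circ> inv_into {..<2 ^ m} bits"
  have \<psi>: "\<psi> (bits r) = v r" if "r < 2 ^ m" for r
    using bij_betw_bits[of m] that by (simp add: \<psi>_def bij_betw_def)
  have "mvec (2 ^ m) (pstr_mat m P) v r = pauli_op m P \<psi> (bits r)" if "r < 2 ^ m" for r
  proof -
    have "mvec (2 ^ m) (pstr_mat m P) v r = (\<Sum>c<2 ^ m. pstr_mat m P r c * \<psi> (bits c))"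
      unfolding mvec_def by (intro sum.cong refl) (simp add: \<psi>)
    then show ?thesis using pstr_mat_apply[OF P that] by simp
  qed
  then have "(\<Sum>r<2 ^ m. (cmod (mvec (2 ^ m) (pstr_mat m P) v r))\<^sup>2)
      = (\<Sum>r<2 ^ m. (cmod (pauli_op m P \<psi> (bits r)))\<^sup>2)" by simp
  also have "\<dots> = (\<Sum>\<beta>\<in>assignments m. (cmod (pauli_op m P \<psi> \<beta>))\<^sup>2)"
    by (rule sum.reindex_bij_betw[OF bij_betw_bits])
  also have "\<dots> = (\<Sum>\<beta>\<in>assignments m. (cmod (\<psi> (pstr_flip P \<beta>)))\<^sup>2)"
    by (simp add: pauli_op_def norm_mult cmod_pstr_phase)
  also have "\<dots> = (\<Sum>\<beta>\<in>assignments m. (cmod (\<psi> \<beta>))\<^sup>2)"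
    by (rule sum.reindex_bij_witness[of _ "pstr_flip P" "pstr_flip P"])
      (auto simp: pstr_flip_assignments[OF P])
  also have "\<dots> = (\<Sum>r<2 ^ m. (cmod (\<psi> (bits r)))\<^sup>2)"
    by (rule sum.reindex_bij_betw[OF bij_betw_bits, symmetric])
  also have "\<dots> = (\<Sum>r<2 ^ m. (cmod (v r))\<^sup>2)" by (simp add: \<psi>)
  finally show ?thesis by (simp add: vnorm_def)
qed

section \<open>The block encoding\<close>

text \<open>z^d (1 - |P|^2) agrees on the circle with a polynomial of degree at most 2 d; Q is its
  Fejer-Riesz square root.\<close>

lemma complementary_poly_exists:
  assumes "degree P \<le> d" "\<And>z. cmod z = 1 \<Longrightarrow> cmod (poly P z) < 1"
  shows "\<exists>Q. degree Q \<le> d \<and> (\<forall>z. cmod z = 1 \<longrightarrow> (cmod (poly P z))\<^sup>2 + (cmod (poly Q z))\<^sup>2 = 1)"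
proof -
  define F where "F = monom 1 d - P * crev d P"
  have deg_crev: "degree (crev d P) \<le> d"
    by (rule degree_le) (simp add: coeff_crev)
  have "degree (P * crev d P) \<le> 2 * d"
    using degree_mult_le[of P "crev d P"] assms(1) deg_crev by linarith
  moreover have "degree (monom (1 :: complex) d) \<le> 2 * d" using degree_monom_le[of "1 :: complex" d] by linarith
  ultimately have deg: "degree F \<le> 2 * d" unfolding F_def by (rule degree_diff_le[rotated])
  have F: "poly F z = complex_of_real (1 - (cmod (poly P z))\<^sup>2) * z ^ d" if z: "cmod z = 1" for z
  proof -
    have "poly F z = z ^ d - (poly P z * cnj (poly P z)) * z ^ d"
      by (simp add: F_def poly_monom poly_crev_unit[OF assms(1) z])
    also have "\<dots> = complex_of_real (1 - (cmod (poly P z))\<^sup>2) * z ^ d"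
      by (simp only: complex_norm_square[symmetric] of_real_diff of_real_1 left_diff_distrib mult_1)
    finally show ?thesis .
  qed
  have "\<exists>r>0. poly F z = complex_of_real r * z ^ d" if z: "cmod z = 1" for z
    using assms(2)[OF z] by (intro exI[of _ "1 - (cmod (poly P z))\<^sup>2"]) (simp add: F[OF z] abs_square_less_1)
  from fejer_riesz[OF deg this] obtain Q where Q: "degree Q \<le> d"
    "\<And>z. cmod z = 1 \<Longrightarrow> poly F z = complex_of_real ((cmod (poly Q z))\<^sup>2) * z ^ d" by blast
  have "(cmod (poly P z))\<^sup>2 + (cmod (poly Q z))\<^sup>2 = 1" if z: "cmod z = 1" for z
  proof -
    have "z ^ d \<noteq> 0" using z by auto
    then have "complex_of_real (1 - (cmod (poly P z))\<^sup>2) = complex_of_real ((cmod (poly Q z))\<^sup>2)"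
      using F[OF z] Q(2)[OF z] by (metis mult_right_cancel)
    then show ?thesis unfolding of_real_eq_iff by linarith
  qed
  then show ?thesis using Q(1) by blast
qed

lemma sum_2pow_add:
  fixes f :: "nat \<Rightarrow> complex"
  shows "(\<Sum>c<2 ^ (m + k). f c) = (\<Sum>x<2 ^ k. \<Sum>s<2 ^ m. f (x * 2 ^ m + s))"
  using sum_mult_product[of f "2 ^ k" "2 ^ m"] by (simp add: power_add mult.commute add.commute)

lemma mvec_cong: "(\<And>j. j < d \<Longrightarrow> u j = v j) \<Longrightarrow> mvec d A u i = mvec d A v i"
  by (simp add: mvec_def)

definition basis_state :: "nat \<Rightarrow> nat \<Rightarrow> state" where
  "basis_state m s \<beta> = (if \<forall>j<m. \<beta> j = bits s j then 1 else 0)"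

lemma sys_only_basis_state: "sys_only m (basis_state m s)"
  by (simp add: sys_only_def basis_state_def)

lemma bits_inject: "r < 2 ^ n \<Longrightarrow> s < 2 ^ n \<Longrightarrow> bits r = bits s \<longleftrightarrow> r = s"
  using bij_betw_bits[of n] by (auto simp: bij_betw_def inj_on_def)

lemma basis_state_bits:
  assumes "s < 2 ^ m" "s' < 2 ^ m"
  shows "basis_state m s' (bits (x * 2 ^ m + s)) = (if s = s' then 1 else 0)"
proof -
  have "(\<forall>j<m. bits s j = bits s' j) \<longleftrightarrow> bits s = bits s'"
    using bits_less[OF assms(1)] bits_less[OF assms(2)]
    by (auto simp: assignments_def fun_eq_iff) (metis not_less)+
  then show ?thesis using bits_inject[OF assms] by (simp add: basis_state_def bits_combine[OF assms(1)])
qed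

text \<open>Ancilla bits a and a + 1 are the coefficient and the signal qubit; the ancilla indices
  with both at 0 form an initial segment.\<close>

lemma less_2pow_iff:
  assumes "x < 2 ^ (a + 2)" shows "x < 2 ^ a \<longleftrightarrow> \<not> bits x a \<and> \<not> bits x (a + 1)"
proof
  assume "x < 2 ^ a"
  then show "\<not> bits x a \<and> \<not> bits x (a + 1)" using bits_less[of x a] by (simp add: assignments_def)
next
  assume n: "\<not> bits x a \<and> \<not> bits x (a + 1)"
  have "\<not> bits x j" if "j \<ge> a" for j
  proof -
    have "j = a \<or> j = a + 1 \<or> j \<ge> a + 2" using that by linarith
    then show ?thesis using n bits_less[OF assms] by (auto simp: assignments_def)
  qed
  then have "bits x \<in> bits ` {..<2 ^ a}"
    using bij_betw_imp_surj_on[OF bij_betw_bits[of a]] by (simp add: assignments_def)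
  then obtain y where y: "y < 2 ^ a" "bits x = bits y" by auto
  then have "y < 2 ^ (a + 2)" by (simp add: power_add)
  then show "x < 2 ^ a" using bits_inject[OF assms, of y] y by simp
qed

context lcu
begin

definition encoded :: cmat where
  "encoded r c = (\<Sum>j<2 ^ a. complex_of_real (\<kappa> j) * pstr_mat m (P j) r c) / 2 ^ a"

lemma ham_bits:
  assumes "r < 2 ^ m" shows "ham v (bits r) = mvec (2 ^ m) encoded (\<lambda>c. v (bits c)) r"
proof -
  have "ham v (bits r) = (\<Sum>j<2 ^ a. complex_of_real (\<kappa> j) * (\<Sum>c<2 ^ m. pstr_mat m (P j) r c * v (bits c))) / 2 ^ a"
    unfolding ham_def pauli_op_mono[OF supp_P m_le_N] pstr_mat_apply[OF supp_P assms] ..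
  also have "\<dots> = mvec (2 ^ m) encoded (\<lambda>c. v (bits c)) r"
    unfolding mvec_def encoded_def sum_divide_distrib sum_distrib_left sum_distrib_right
    by (subst sum.swap) (simp add: mult.assoc)
  finally show ?thesis .
qed

lemma ham_pow_bits:
  "r < 2 ^ m \<Longrightarrow> (ham ^^ n) v (bits r) = mvec (2 ^ m) (mpow (2 ^ m) encoded n) (\<lambda>c. v (bits c)) r"
proof (induction n arbitrary: r)
  case 0
  then show ?case by (simp add: mvec_mid)
next
  case (Suc n)
  have "(ham ^^ Suc n) v (bits r) = mvec (2 ^ m) encoded (\<lambda>c. (ham ^^ n) v (bits c)) r"
    using ham_bits[OF Suc.prems] by simp
  also have "\<dots> = mvec (2 ^ m) encoded (mvec (2 ^ m) (mpow (2 ^ m) encoded n) (\<lambda>c. v (bits c))) r"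
    by (rule mvec_cong) (rule Suc.IH)
  finally show ?case by (simp add: mvec_mmul)
qed

lemma sys_only_taylor_ham: "sys_only m v \<Longrightarrow> sys_only m (taylor_ham \<tau> K v)"
proof -
  assume v: "sys_only m v"
  have "(ham ^^ n) v \<beta> = (ham ^^ n) v \<beta>'" if "\<forall>j<m. \<beta> j = \<beta>' j" for n \<beta> \<beta>'
    using sys_onlyD[OF sys_only_ham_pow[OF v]] that by blast
  then show "sys_only m (taylor_ham \<tau> K v)"
    unfolding sys_only_def taylor_ham_def by (auto intro!: sum.cong)
qed

abbreviation "evolution \<tau> K \<equiv> taylor_mat (2 ^ m) (\<lambda>i j. - \<i> * complex_of_real \<tau> * encoded i j) K"

lemma taylor_ham_basis_state:
  assumes "s < 2 ^ m" "s' < 2 ^ m"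
  shows "taylor_ham \<tau> K (basis_state m s') (bits (x * 2 ^ m + s)) = evolution \<tau> K s s'"
proof -
  have "basis_state m s' (bits c) = (if c = s' then 1 else 0)" if "c < 2 ^ m" for c
    using basis_state_bits[OF that assms(2), of 0] by simp
  then have pow: "(ham ^^ n) (basis_state m s') (bits s) = mpow (2 ^ m) encoded n s s'" for n
    unfolding ham_pow_bits[OF assms(1)] using mvec_unit[OF assms(2), of "mpow (2 ^ m) encoded n" s]
    by (simp add: mvec_def)
  have "taylor_ham \<tau> K (basis_state m s') (bits (x * 2 ^ m + s)) = taylor_ham \<tau> K (basis_state m s') (bits s)"
    by (rule sys_onlyD[OF sys_only_taylor_ham[OF sys_only_basis_state]])
      (simp add: bits_combine[OF assms(1)])
  also have "\<dots> = evolution \<tau> K s s'"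
    by (simp only: taylor_ham_def taylor_mat_def pow mpow_scale times_divide_eq_left of_nat_fact)
  finally show ?thesis .
qed

definition ancilla :: "nat \<Rightarrow> complex" where
  "ancilla x = (if x < 2 ^ a then complex_of_real (1 / sqrt 2) ^ a else 0)"

lemma inverse_sqrt2_pow_sq: "(2 :: complex) ^ a * (complex_of_real (1 / sqrt 2) ^ a * complex_of_real (1 / sqrt 2) ^ a) = 1"
  unfolding power_mult_distrib[symmetric] inverse_sqrt2_sq by simp

lemma sum_ancilla:
  "(\<Sum>x<2 ^ (a + 2). cnj (ancilla x) * F x) = (\<Sum>x<2 ^ a. complex_of_real (1 / sqrt 2) ^ a * F x)"
proof -
  have "(\<Sum>x<2 ^ (a + 2). cnj (ancilla x) * F x) = (\<Sum>x<2 ^ a. cnj (ancilla x) * F x)"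
    by (rule sum.mono_neutral_right) (auto simp: ancilla_def power_add)
  then show ?thesis by (simp add: ancilla_def)
qed

lemma vnorm_ancilla: "vnorm (2 ^ (a + 2)) ancilla = 1"
proof -
  have "complex_of_real (\<Sum>x<2 ^ (a + 2). (cmod (ancilla x))\<^sup>2) = (\<Sum>x<2 ^ (a + 2). cnj (ancilla x) * ancilla x)"
    unfolding of_real_sum by (intro sum.cong refl) (simp only: complex_norm_square mult.commute)
  also have "\<dots> = (\<Sum>x<2 ^ a. complex_of_real (1 / sqrt 2) ^ a * ancilla x)" by (rule sum_ancilla)
  also have "\<dots> = 1" using inverse_sqrt2_pow_sq by (simp add: ancilla_def)
  finally show ?thesis unfolding vnorm_def by (metis of_real_eq_1_iff real_sqrt_one)
qed

text \<open>Summing over the input ancilla gives the image of ancilla state times basis vector,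
  known from the operator calculus. On the output side the \<open>2 ^ a\<close> indices with both
  extra qubits 0 remain, and each contributes two amplitudes with product 1 /
  \<open>2 ^ a\<close>.\<close>

lemma qsp_block_encoding:
  assumes Rs: "\<forall>R\<in>set Rs. unitary2 R" "gqsp Rs = (smult (1 / complex_of_real \<alpha>) (taylor_poly \<tau> K), Q)"
    and \<alpha>: "\<alpha> > 0"
  shows "block_encoding m (a + 2) (circuit_mat N (qsp_circuit Rs K)) \<alpha> (evolution \<tau> K)"
  unfolding block_encoding_def
proof (intro conjI exI[of _ ancilla] allI impI)
  fix s s' :: nat assume s: "s < 2 ^ m" and s': "s' < 2 ^ m"
  let ?U = "circuit_mat N (qsp_circuit Rs K)" and ?h = "complex_of_real (1 / sqrt 2) ^ a"
  let ?\<Psi> = "\<lambda>\<beta>. if \<beta> q then 0 else ket (basis_state m s') \<beta>"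
  have N': "N = m + (a + 2)" by (simp add: N)
  have \<Psi>: "?\<Psi> (bits (x * 2 ^ m + c)) = ancilla x * (if c = s' then 1 else 0)"
    if "x < 2 ^ (a + 2)" "c < 2 ^ m" for x c
    using less_2pow_iff[OF that(1)]
    by (simp add: ket_def ancilla_def basis_state_bits[OF that(2) s'] bits_combine[OF that(2)])
  have col: "(\<Sum>x'<2 ^ (a + 2). ?U r (x' * 2 ^ m + s') * ancilla x') = circuit_op N (qsp_circuit Rs K) ?\<Psi> (bits r)"
    if r: "r < 2 ^ N" for r
  proof -
    have "circuit_op N (qsp_circuit Rs K) ?\<Psi> (bits r) = (\<Sum>c<2 ^ N. ?U r c * ?\<Psi> (bits c))"
      by (rule circuit_apply[symmetric]) (use qsp_circuit_ok[OF Rs(1)] r in auto)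
    also have "\<dots> = (\<Sum>x<2 ^ (a + 2). \<Sum>c<2 ^ m. ?U r (x * 2 ^ m + c) * ?\<Psi> (bits (x * 2 ^ m + c)))"
      unfolding N' by (rule sum_2pow_add)
    also have "\<dots> = (\<Sum>x<2 ^ (a + 2). \<Sum>c<2 ^ m. ?U r (x * 2 ^ m + c) * (ancilla x * (if c = s' then 1 else 0)))"
      by (intro sum.cong refl arg_cong2[of _ _ _ _ times] \<Psi>) auto
    also have "\<dots> = (\<Sum>x<2 ^ (a + 2). ?U r (x * 2 ^ m + s') * ancilla x)"
      using s' by (simp add: if_distrib[of "\<lambda>z. _ * z"] cong: if_cong)
    finally show ?thesis ..
  qed
  have "(\<Sum>x<2 ^ (a + 2). \<Sum>x'<2 ^ (a + 2).
      cnj (ancilla x) * ?U (x * 2 ^ m + s) (x' * 2 ^ m + s') * ancilla x')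
    = (\<Sum>x<2 ^ (a + 2). cnj (ancilla x) * (\<Sum>x'<2 ^ (a + 2). ?U (x * 2 ^ m + s) (x' * 2 ^ m + s') * ancilla x'))"
    by (simp only: sum_distrib_left mult.assoc)
  also have "\<dots> = (\<Sum>x<2 ^ a. ?h * (\<Sum>x'<2 ^ (a + 2). ?U (x * 2 ^ m + s) (x' * 2 ^ m + s') * ancilla x'))"
    by (rule sum_ancilla)
  also have "\<dots> = (\<Sum>x<(2::nat) ^ a. ?h * (1 / complex_of_real \<alpha> * (?h * evolution \<tau> K s s')))"
  proof (intro sum.cong refl arg_cong2[of _ _ _ _ times])
    fix x assume "x \<in> {..<(2::nat) ^ a}"
    then have x: "x < 2 ^ a" "x < 2 ^ (a + 2)" by (auto simp: power_add)
    have "x * 2 ^ m + s < Suc x * 2 ^ m" using s by simp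
    also have "\<dots> \<le> 2 ^ (a + 2) * 2 ^ m" using x(2) by (intro mult_right_mono) auto
    finally have r: "x * 2 ^ m + s < 2 ^ N" by (simp add: N' power_add mult_ac)
    have nb: "\<not> bits (x * 2 ^ m + s) b" "\<not> bits (x * 2 ^ m + s) q"
      using less_2pow_iff[OF x(2)] x(1) by (simp_all add: bits_combine[OF s])
    show "(\<Sum>x'<2 ^ (a + 2). ?U (x * 2 ^ m + s) (x' * 2 ^ m + s') * ancilla x')
        = 1 / complex_of_real \<alpha> * (?h * evolution \<tau> K s s')"
      unfolding col[OF r] qsp_circuit_op[of "basis_state m s'" Rs "1 / complex_of_real \<alpha>" \<tau> K Q "bits (x * 2 ^ m + s)", OF sys_only_basis_state Rs(2) nb(2)]
      using nb(1) by (simp add: ket_def taylor_ham_basis_state[OF s s'] del: of_real_divide)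
  qed
  also have "\<dots> = (2 ^ a * (?h * ?h)) * evolution \<tau> K s s' / complex_of_real \<alpha>"
    by (simp del: of_real_divide)
  also have "\<dots> = evolution \<tau> K s s' / complex_of_real \<alpha>"
    unfolding inverse_sqrt2_pow_sq by simp
  finally show "(\<Sum>x<2 ^ (a + 2). \<Sum>x'<2 ^ (a + 2).
      cnj (ancilla x) * ?U (x * 2 ^ m + s) (x' * 2 ^ m + s') * ancilla x')
    = evolution \<tau> K s s' / complex_of_real \<alpha>" .
qed (use vnorm_ancilla \<alpha> in auto)

text \<open>On the circle the polynomial is z^K times the truncated series at x = Re z in [-1, 1],
  so the scalar bound applies directly.\<close>

lemma qsp_angles_exist:
  assumes "0 \<le> \<tau>" "exp (exp 1 * \<tau> - real K) \<le> \<epsilon>" "0 < \<epsilon>"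
  shows "\<exists>Rs Q. length Rs = Suc (2 * K) \<and> (\<forall>R\<in>set Rs. unitary2 R) \<and>
    gqsp Rs = (smult (1 / complex_of_real (1 + 2 * \<epsilon>)) (taylor_poly \<tau> K), Q)"
proof -
  let ?P = "smult (1 / complex_of_real (1 + 2 * \<epsilon>)) (taylor_poly \<tau> K)"
  have deg: "degree ?P \<le> 2 * K"
    using degree_taylor_poly[of \<tau> K] by (intro order_trans[OF degree_smult_le])
  have "cmod (poly ?P z) < 1" if z: "cmod z = 1" for z
  proof -
    have "\<bar>Re z\<bar> \<le> 1" using abs_Re_le_cmod[of z] z by simp
    from cmod_exp_taylor[OF assms(1) this, of K]
    have "cmod (poly (taylor_poly \<tau> K) z) < 1 + 2 * \<epsilon>"
      using assms(2,3) by (simp add: poly_taylor_poly[OF z] norm_mult norm_power z)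
    moreover have "cmod (complex_of_real (1 + 2 * \<epsilon>)) = 1 + 2 * \<epsilon>"
      using assms(3) by (simp only: norm_of_real)
    ultimately show ?thesis using assms(3) by (simp add: norm_mult norm_divide del: of_real_add)
  qed
  from complementary_poly_exists[OF deg this] obtain Q where Q: "degree Q \<le> 2 * K"
    "\<And>z. cmod z = 1 \<Longrightarrow> (cmod (poly ?P z))\<^sup>2 + (cmod (poly Q z))\<^sup>2 = 1" by blast
  show ?thesis using gqsp_exists[OF deg Q] by blast
qed

section \<open>Gate counts\<close>

lemma cost_select: "circuit_cost select = 2 ^ a * (2 * (a + 1))"
proof -
  have cost_term: "circuit_cost (ctrl (index_controls j) (term_gates j)) = 2 * (a + 1)" for j
    by (simp add: circuit_cost_ctrl term_gates_def gate_cost_def index_controls_def)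
  have "circuit_cost (select_list js) = length js * (2 * (a + 1))" for js
    by (induction js) (simp_all add: select_list_def cost_term)
  then show ?thesis by (simp add: select_def)
qed

lemma cost_refl_upto: "circuit_cost (refl_upto i) = a + 2 + 2 * i"
  by (induction i) (simp_all add: zero_refl_def gate_cost_def)

lemma cost_walk: "circuit_cost walk \<le> 5 * (2 ^ a * (a + 1))" "circuit_cost unwalk = circuit_cost walk"
proof -
  have "a + 2 + 2 * a \<le> 3 * (1 * (a + 1))" by simp
  also have "\<dots> \<le> 3 * (2 ^ a * (a + 1))" by (intro mult_left_mono mult_right_mono) auto
  finally show "circuit_cost walk \<le> 5 * (2 ^ a * (a + 1))"
    by (simp add: walk_def refl_def cost_select cost_refl_upto algebra_simps)
qed (simp add: walk_def unwalk_def)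

text \<open>One more control costs one unit per gate and so at most doubles the cost of the walk;
  the summand 1 is the rotation.\<close>

lemma cost_gqsp_circuit: "circuit_cost (gqsp_circuit q walk Rs) \<le> length Rs * (1 + 2 * circuit_cost walk)"
  using length_le_circuit_cost[of walk]
  by (induction Rs) (auto simp: circuit_cost_ctrl gate_cost_def)

text \<open>With w the cost of the walk: 2 K + 1 <= 3 K stages of at most 1 + 2 w <= 3 w each, plus
  K w for the inverse walks, give 10 K w, and w is at most 5 times
  \<open>2 ^ a * (a + 1)\<close>.\<close>

lemma cost_qsp_circuit:
  assumes "length Rs = Suc (2 * K)" "K \<ge> 1"
  shows "circuit_cost (qsp_circuit Rs K) \<le> 50 * K * (2 ^ a * (a + 1))"
proof -
  let ?w = "circuit_cost walk"
  have "1 \<le> (2::nat) ^ a * (2 * (a + 1))"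
    using mult_le_mono[of 1 "2 ^ a" 1 "2 * (a + 1)"] by simp
  then have w: "1 \<le> ?w" using cost_select by (simp only: walk_def circuit_cost_append trans_le_add1)
  have "circuit_cost (unwalks K) = K * ?w"
    by (induction K) (simp_all add: unwalks_def cost_walk(2))
  then have "circuit_cost (qsp_circuit Rs K) \<le> Suc (2 * K) * (1 + 2 * ?w) + K * ?w"
    using cost_gqsp_circuit[of Rs] assms(1) by (simp add: qsp_circuit_def)
  also have "\<dots> \<le> (3 * K) * (3 * ?w) + K * ?w"
    using assms(2) w by (intro add_mono mult_mono) auto
  also have "\<dots> = K * (10 * ?w)" by simp
  also have "\<dots> \<le> K * (10 * (5 * (2 ^ a * (a + 1))))"
    using cost_walk(1) by (intro mult_left_mono) auto
  finally show ?thesis by (simp add: mult_ac)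
qed

end

section \<open>Site-local Hamiltonians\<close>

lemma exists_pow2_between:
  assumes "1 \<le> M" shows "\<exists>a. M \<le> 2 ^ a \<and> 2 ^ a \<le> 2 * (M :: nat)"
proof -
  define a where "a = (LEAST a. M \<le> 2 ^ a)"
  have M: "M \<le> 2 ^ a" unfolding a_def by (rule LeastI[of _ M]) (simp add: less_imp_le less_exp)
  have "2 ^ a \<le> 2 * M"
  proof (cases a)
    case 0
    then show ?thesis using assms by simp
  next
    case (Suc a')
    then have "\<not> M \<le> 2 ^ a'" using not_less_Least[of a' "\<lambda>a. M \<le> 2 ^ a"] by (simp add: a_def)
    then show ?thesis using Suc by simp
  qed
  then show ?thesis using M by blast
qed

lemma block_encoding_identity: "block_encoding m 0 mid 1 mid"
  unfolding block_encoding_def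
  by (auto intro!: exI[of _ "\<lambda>_. 1"] simp: vnorm_def)

locale site_ham =
  fixes NL nq :: nat and S :: "nat set set" and coef :: "nat set \<Rightarrow> pstring \<Rightarrow> real"
  assumes slh: "site_local_ham NL nq S coef"
begin

abbreviation "n \<equiv> NL * nq"

text \<open>Indexing by pairs keeps a string that occurs in several H_J as several terms, so no
  coefficients have to be merged.\<close>

definition T :: "(nat set \<times> pstring) set" where
  "T = Sigma S (terms coef)"

lemma finite_S: "finite S" and finite_terms: "J \<in> S \<Longrightarrow> finite (terms coef J)"
  using slh by (auto simp: site_local_ham_def)

lemma finite_T: "finite T"
  unfolding T_def by (intro finite_SigmaI finite_S finite_terms)

lemma supp_T:
  assumes "x \<in> T" shows "pstr_supp (snd x) \<subseteq> {..<n}"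
proof
  fix j assume "j \<in> pstr_supp (snd x)"
  moreover have "fst x \<in> S" "snd x \<in> terms coef (fst x)" using assms by (auto simp: T_def)
  then have "fst x \<subseteq> {..<NL}" "pstr_supp (snd x) \<subseteq> qubits_of nq (fst x)"
    using slh unfolding site_local_ham_def by blast+
  ultimately have "nq > 0" "j div nq < NL" by (auto simp: qubits_of_def)
  then show "j \<in> {..<n}" by (simp add: div_less_iff_less_mult)
qed

lemma ham_mat_T: "ham_mat NL nq S coef r c = (\<Sum>x\<in>T. complex_of_real (coef (fst x) (snd x)) * pstr_mat n (snd x) r c)"
  unfolding ham_mat_def T_def using finite_S finite_terms
  by (subst sum.Sigma) (auto simp: case_prod_beta)

lemma cP_eq: "cP S coef = Max (insert 0 ((\<lambda>x. \<bar>coef (fst x) (snd x)\<bar>) ` T))"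
  unfolding cP_def T_def by (rule arg_cong[of _ _ Max]) force

lemma coef_le_cP: "x \<in> T \<Longrightarrow> \<bar>coef (fst x) (snd x)\<bar> \<le> cP S coef"
  unfolding cP_eq by (rule Max_ge) (auto simp: finite_T)

lemma cP_nonneg: "0 \<le> cP S coef"
  unfolding cP_eq by (rule Max_ge) (auto simp: finite_T)

lemma cP_pos:
  assumes "T \<noteq> {}" shows "0 < cP S coef"
proof -
  obtain x where x: "x \<in> T" using assms by blast
  then have "0 < \<bar>coef (fst x) (snd x)\<bar>" by (auto simp: T_def terms_def)
  then show ?thesis using coef_le_cP[OF x] by linarith
qed

lemma card_terms_le_NP: "J \<in> S \<Longrightarrow> card (terms coef J) \<le> NP S coef"
  unfolding NP_def by (rule Max_ge) (auto simp: finite_S)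

text \<open>This is how the lattice size enters the constant: S is a set of subsets of NL
  sites.\<close>

lemma card_T_le: "card T \<le> 2 ^ NL * NP S coef"
proof -
  have "S \<subseteq> Pow {..<NL}" using slh by (auto simp: site_local_ham_def)
  then have S: "card S \<le> 2 ^ NL" using card_mono[of "Pow {..<NL}" S] by (simp add: card_Pow)
  have "card T = (\<Sum>J\<in>S. card (terms coef J))"
    unfolding T_def using finite_S finite_terms by (intro card_SigmaI) auto
  also have "\<dots> \<le> card S * NP S coef"
    using sum_mono[of S "\<lambda>J. card (terms coef J)" "\<lambda>_. NP S coef"] card_terms_le_NP by simp
  also have "\<dots> \<le> 2 ^ NL * NP S coef" by (rule mult_right_mono[OF S]) simp
  finally show ?thesis .
qed

lemma NP_pos: "T \<noteq> {} \<Longrightarrow> 0 < NP S coef"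
  using card_T_le finite_T by (cases "NP S coef") auto

text \<open>Pauli strings preserve the norm, so the triangle inequality over T suffices. The slack
  in \<tau> accommodates the padded number of terms.\<close>

lemma bounded_generator:
  assumes t: "0 \<le> t" and \<tau>: "t * real (card T) * cP S coef \<le> \<tau>"
  shows "bounded_mat (2 ^ n) (\<lambda>r c. - \<i> * complex_of_real t * ham_mat NL nq S coef r c) \<tau>"
proof
  have "0 \<le> t * real (card T) * cP S coef" using t cP_nonneg by simp
  then show "0 \<le> \<tau>" using \<tau> by linarith
  fix v
  let ?c = "\<lambda>x. - \<i> * complex_of_real t * complex_of_real (coef (fst x) (snd x))"
  have "mvec (2 ^ n) (\<lambda>r c. - \<i> * complex_of_real t * ham_mat NL nq S coef r c) v
      = (\<lambda>i. \<Sum>x\<in>T. ?c x * mvec (2 ^ n) (pstr_mat n (snd x)) v i)"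
    unfolding mvec_def ham_mat_T sum_distrib_left sum_distrib_right
    by (rule ext, subst sum.swap) (simp add: mult.assoc)
  then have "vnorm (2 ^ n) (mvec (2 ^ n) (\<lambda>r c. - \<i> * complex_of_real t * ham_mat NL nq S coef r c) v)
      = vnorm (2 ^ n) (\<lambda>i. \<Sum>x\<in>T. ?c x * mvec (2 ^ n) (pstr_mat n (snd x)) v i)" by simp
  also have "\<dots> \<le> (\<Sum>x\<in>T. cmod (?c x) * vnorm (2 ^ n) (mvec (2 ^ n) (pstr_mat n (snd x)) v))"
    by (rule vnorm_sum_le[OF finite_T])
  also have "\<dots> \<le> (\<Sum>x\<in>T. (t * cP S coef) * vnorm (2 ^ n) v)"
    using t coef_le_cP
    by (intro sum_mono) (simp add: vnorm_pstr_mat[OF supp_T] norm_mult mult_right_mono mult_left_mono vnorm_nonneg)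
  also have "\<dots> = t * real (card T) * cP S coef * vnorm (2 ^ n) v" by simp
  also have "\<dots> \<le> \<tau> * vnorm (2 ^ n) v" by (rule mult_right_mono[OF \<tau> vnorm_nonneg])
  finally show "vnorm (2 ^ n) (mvec (2 ^ n) (\<lambda>r c. - \<i> * complex_of_real t * ham_mat NL nq S coef r c) v)
    \<le> \<tau> * vnorm (2 ^ n) v" .
qed

text \<open>The identity is the Taylor truncation of degree 0.\<close>

lemma simulation_trivial:
  assumes t: "0 \<le> t" and small: "exp (t * real (card T) * cP S coef) - 1 \<le> \<epsilon>"
  shows "op_norm (2 ^ n) (\<lambda>i j. mid i j - mexp (2 ^ n)
    (\<lambda>r c. - \<i> * complex_of_real t * ham_mat NL nq S coef r c) i j) \<le> \<epsilon>"
proof -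
  interpret bounded_mat "2 ^ n" "\<lambda>r c. - \<i> * complex_of_real t * ham_mat NL nq S coef r c"
    "t * real (card T) * cP S coef"
    by (rule bounded_generator[OF t]) simp
  have "taylor_mat (2 ^ n) B 0 = mid" for B by (intro ext) (simp add: taylor_mat_def)
  then show ?thesis
    using taylor_mat_error[of 0, OF _ order_trans[OF exp_tail_0[OF \<tau>] small]] by simp
qed

lemma simulation:
  assumes t: "0 < t" and \<epsilon>: "0 < \<epsilon>" and T: "T \<noteq> {}"
    and a: "card T \<le> 2 ^ a" and K: "1 \<le> K" "exp 1 * (2 ^ a * cP S coef * t) + ln (1 / \<epsilon>) \<le> real K"
  shows "\<exists>circ A. (\<forall>g\<in>set circ. gate_ok (n + (a + 2)) g) \<and>
    block_encoding n (a + 2) (circuit_mat (n + (a + 2)) circ) (1 + 2 * \<epsilon>) A \<and>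
    op_norm (2 ^ n) (\<lambda>i j. A i j - mexp (2 ^ n)
      (\<lambda>r c. - \<i> * complex_of_real t * ham_mat NL nq S coef r c) i j) \<le> \<epsilon> \<and>
    circuit_cost circ \<le> 50 * K * (2 ^ a * (a + 1))"
proof -
  define c where "c = cP S coef"
  have c: "c > 0" unfolding c_def by (rule cP_pos[OF T])
  obtain h where h: "bij_betw h {0..<card T} T" using ex_bij_betw_nat_finite[OF finite_T] by blast
  then have hT: "h j \<in> T" if "j < card T" for j using that by (auto simp: bij_betw_def)
  \<comment> \<open>Division by the largest coefficient brings all of them into [-1, 1]; indices
    from \<open>card T\<close> on are padding. As the encoded average also divides by
    \<open>2 ^ a\<close>, the time \<tau> = \<open>2 ^ a * c * t\<close> restores t H.\<close>
  define \<kappa> where "\<kappa> j = (if j < card T then coef (fst (h j)) (snd (h j)) / c else 0)" for j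
  define P where "P j = (if j < card T then snd (h j) else (\<lambda>_. PI))" for j
  define \<tau> where "\<tau> = 2 ^ a * c * t"
  interpret L: lcu n a "n + (a + 2)" \<kappa> P
  proof
    show "n + (a + 2) = n + a + 2" by simp
    show "\<bar>\<kappa> j\<bar> \<le> 1" for j
      using coef_le_cP[OF hT, of j] c by (simp add: \<kappa>_def c_def)
    show "pstr_supp (P j) \<subseteq> {..<n}" for j
      using supp_T[OF hT, of j] by (auto simp: P_def pstr_supp_def)
  qed
  have encoded: "complex_of_real \<tau> * L.encoded r s = complex_of_real t * ham_mat NL nq S coef r s" for r s
  proof -
    have "(\<Sum>j<2 ^ a. complex_of_real (\<kappa> j) * pstr_mat n (P j) r s)
        = (\<Sum>j<card T. complex_of_real (\<kappa> j) * pstr_mat n (P j) r s)"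
      by (rule sum.mono_neutral_right) (use a in \<open>auto simp: \<kappa>_def\<close>)
    also have "\<dots> = (\<Sum>j<card T. complex_of_real (coef (fst (h j)) (snd (h j)) / c) * pstr_mat n (snd (h j)) r s)"
      by (intro sum.cong refl) (simp add: \<kappa>_def P_def)
    also have "\<dots> = (\<Sum>x\<in>T. complex_of_real (coef (fst x) (snd x) / c) * pstr_mat n (snd x) r s)"
      using sum.reindex_bij_betw[OF h] by (simp add: lessThan_atLeast0)
    also have "\<dots> = ham_mat NL nq S coef r s / complex_of_real c"
      by (simp add: ham_mat_T sum_divide_distrib)
    finally show ?thesis using c by (simp add: L.encoded_def \<tau>_def)
  qed
  then have gen: "(\<lambda>i j. - \<i> * complex_of_real \<tau> * L.encoded i j)
      = (\<lambda>r s. - \<i> * complex_of_real t * ham_mat NL nq S coef r s)"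
    by (simp add: mult.assoc)
  have card: "t * real (card T) * cP S coef \<le> \<tau>"
  proof -
    have "real (card T) \<le> 2 ^ a" using a by (metis of_nat_le_iff of_nat_numeral of_nat_power)
    then show ?thesis using t c unfolding \<tau>_def c_def by (simp add: mult.commute mult.left_commute)
  qed
  interpret bounded_mat "2 ^ n" "\<lambda>r s. - \<i> * complex_of_real t * ham_mat NL nq S coef r s" \<tau>
    by (rule bounded_generator[OF _ card]) (use t in simp)
  have "exp 1 * \<tau> - real K \<le> - ln (1 / \<epsilon>)" using K(2) by (simp add: \<tau>_def c_def)
  then have "exp (exp 1 * \<tau> - real K) \<le> exp (- ln (1 / \<epsilon>))" by simp
  also have "\<dots> = \<epsilon>" using \<epsilon> by (simp add: ln_div)
  finally have tail: "exp (exp 1 * \<tau> - real K) \<le> \<epsilon>" .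
  obtain Rs Q where Rs: "length Rs = Suc (2 * K)" "\<forall>R\<in>set Rs. unitary2 R"
    "gqsp Rs = (smult (1 / complex_of_real (1 + 2 * \<epsilon>)) (taylor_poly \<tau> K), Q)"
    using L.qsp_angles_exist[OF \<tau> tail \<epsilon>] by blast
  show ?thesis
  proof (intro exI conjI)
    show "\<forall>g\<in>set (L.qsp_circuit Rs K). gate_ok (n + (a + 2)) g"
      using L.qsp_circuit_ok[OF Rs(2)] by blast
    show "block_encoding n (a + 2) (circuit_mat (n + (a + 2)) (L.qsp_circuit Rs K)) (1 + 2 * \<epsilon>)
        (taylor_mat (2 ^ n) (\<lambda>r s. - \<i> * complex_of_real t * ham_mat NL nq S coef r s) K)"
      using L.qsp_block_encoding[OF Rs(2,3)] \<epsilon> unfolding gen by simp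
    show "op_norm (2 ^ n) (\<lambda>i j. taylor_mat (2 ^ n) (\<lambda>r s. - \<i> * complex_of_real t * ham_mat NL nq S coef r s) K i j
        - mexp (2 ^ n) (\<lambda>r c. - \<i> * complex_of_real t * ham_mat NL nq S coef r c) i j) \<le> \<epsilon>"
      by (rule taylor_mat_error[OF _ order_trans[OF exp_tail[OF \<tau>] tail]]) simp
    show "circuit_cost (L.qsp_circuit Rs K) \<le> 50 * K * (2 ^ a * (a + 1))"
      by (rule L.cost_qsp_circuit[OF Rs(1) K(1)])
  qed
qed

end

text \<open>The constant depends on L alone, hence is uniform in the qubits per site, the terms, t
  and \<epsilon>. The argument NP + 1 keeps the logarithm positive when every H_J has a single
  term.\<close>

theorem theorem3p8:
  shows "\<forall>L::nat. \<exists>C::real. C > 0 \<and>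
    (\<forall>NL nq S coef (t::real) (\<epsilon>::real).
       NL \<le> L \<longrightarrow> site_local_ham NL nq S coef \<longrightarrow> t > 0 \<longrightarrow> 0 < \<epsilon> \<longrightarrow> \<epsilon> < 1 \<longrightarrow>
       (\<exists>k circ \<alpha> A.
          (\<forall>g\<in>set circ. gate_ok (NL * nq + k) g) \<and>
          block_encoding (NL * nq) k (circuit_mat (NL * nq + k) circ) \<alpha> A \<and>
          \<bar>\<alpha> - 1\<bar> \<le> C * \<epsilon> \<and>
          real k \<le> C * log 2 (real (NP S coef) + 1) \<and>
          op_norm (2 ^ (NL * nq))
            (\<lambda>i j. A i j - mexp (2 ^ (NL * nq))
                      (\<lambda>r c. - \<i> * complex_of_real t * ham_mat NL nq S coef r c) i j) \<le> \<epsilon> \<and>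
          real (circuit_cost circ) \<le> C * real (NP S coef) * log 2 (real (NP S coef) + 1) *
             (real (NP S coef) * cP S coef * t + ln (1 / \<epsilon>))))"
proof
  fix L :: nat
  define D :: real where "D = 2 ^ L"
  \<comment> \<open>1600 = 50 * 16 * 2: circuit cost, bound on K, padding to a power of two. One
    factor D comes from K and one from \<open>2 ^ a\<close>; L + 4 comes from a + 2 <= (L + 4)
    lg.\<close>
  define C where "C = 1600 * D\<^sup>2 * (real L + 4)"
  have D: "D \<ge> 1" by (simp add: D_def)
  have "D\<^sup>2 \<ge> 1" using D by (simp add: one_le_power)
  then have C1: "1600 * 1 * (real L + 4) \<le> C" unfolding C_def by (intro mult_right_mono mult_left_mono) auto
  then have C2: "C \<ge> 2" and CL: "C \<ge> real L + 4" by simp_all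
  show "\<exists>C::real. C > 0 \<and>
    (\<forall>NL nq S coef (t::real) (\<epsilon>::real).
       NL \<le> L \<longrightarrow> site_local_ham NL nq S coef \<longrightarrow> t > 0 \<longrightarrow> 0 < \<epsilon> \<longrightarrow> \<epsilon> < 1 \<longrightarrow>
       (\<exists>k circ \<alpha> A.
          (\<forall>g\<in>set circ. gate_ok (NL * nq + k) g) \<and>
          block_encoding (NL * nq) k (circuit_mat (NL * nq + k) circ) \<alpha> A \<and>
          \<bar>\<alpha> - 1\<bar> \<le> C * \<epsilon> \<and>
          real k \<le> C * log 2 (real (NP S coef) + 1) \<and>
          op_norm (2 ^ (NL * nq))
            (\<lambda>i j. A i j - mexp (2 ^ (NL * nq))
                      (\<lambda>r c. - \<i> * complex_of_real t * ham_mat NL nq S coef r c) i j) \<le> \<epsilon> \<and>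
          real (circuit_cost circ) \<le> C * real (NP S coef) * log 2 (real (NP S coef) + 1) *
             (real (NP S coef) * cP S coef * t + ln (1 / \<epsilon>))))"
  proof (intro exI[of _ C] conjI allI impI)
    show "C > 0" using C2 by simp
    fix NL nq S coef and t \<epsilon> :: real
    assume NL: "NL \<le> L" and slh: "site_local_ham NL nq S coef" and t: "t > 0" and \<epsilon>: "0 < \<epsilon>" "\<epsilon> < 1"
    interpret site_ham NL nq S coef by unfold_locales (rule slh)
    define p where "p = real (NP S coef)"
    define x where "x = p * cP S coef * t"
    define l where "l = ln (1 / \<epsilon>)"
    define lg where "lg = log 2 (p + 1)"
    have p: "p \<ge> 0" and x: "x \<ge> 0" and l: "l > 0" and lg0: "lg \<ge> 0"
      using \<epsilon> t cP_nonneg by (simp_all add: p_def x_def l_def lg_def)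
    have "real (card T) \<le> 2 ^ NL * p"
      using card_T_le unfolding p_def by (metis of_nat_le_iff of_nat_mult of_nat_numeral of_nat_power)
    also have "\<dots> \<le> D * p" unfolding D_def using NL p by (intro mult_right_mono power_increasing) auto
    finally have card: "real (card T) \<le> D * p" .
    have tx: "t * real (card T) * cP S coef \<le> D * x"
      using mult_right_mono[OF card, of "cP S coef * t"] t cP_nonneg by (simp add: x_def mult_ac)
    show "\<exists>k circ \<alpha> A.
          (\<forall>g\<in>set circ. gate_ok (NL * nq + k) g) \<and>
          block_encoding (NL * nq) k (circuit_mat (NL * nq + k) circ) \<alpha> A \<and>
          \<bar>\<alpha> - 1\<bar> \<le> C * \<epsilon> \<and>
          real k \<le> C * log 2 (real (NP S coef) + 1) \<and>
          op_norm (2 ^ (NL * nq))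
            (\<lambda>i j. A i j - mexp (2 ^ (NL * nq))
                      (\<lambda>r c. - \<i> * complex_of_real t * ham_mat NL nq S coef r c) i j) \<le> \<epsilon> \<and>
          real (circuit_cost circ) \<le> C * real (NP S coef) * log 2 (real (NP S coef) + 1) *
             (real (NP S coef) * cP S coef * t + ln (1 / \<epsilon>))"
    \<comment> \<open>Rounding \<open>K\<close> up costs an additive constant, which only \<open>x + l\<close> bounded below can absorb.\<close>
    proof (cases "T = {} \<or> 4 * D * (x + l) < 1")
      case True
      have "exp (t * real (card T) * cP S coef) - 1 \<le> \<epsilon>"
      proof (cases "T = {}")
        case True
        then show ?thesis using \<epsilon> by simp
      next
        case False
        \<comment> \<open>Here D x and l are both below 1/4, so \<epsilon> = exp (- l) is at least
          3/4, whereas exp (D x) - 1 is at most 5/16.\<close>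
        then have s: "4 * D * (x + l) < 1" using \<open>T = {} \<or> _\<close> by blast
        have "1 * l \<le> D * (x + l)" by (rule mult_mono) (use D x l in auto)
        moreover have "0 \<le> D * x" "D * x \<le> D * (x + l)" using D x l by auto
        ultimately have small: "0 \<le> D * x" "D * x \<le> 1 / 4" "l \<le> 1 / 4" using s by linarith+
        have "exp (t * real (card T) * cP S coef) \<le> exp (1 / 4)" using tx small by simp
        also have "\<dots> \<le> 1 + 1 / 4 + (1 / 4)\<^sup>2" by (rule exp_bound) auto
        also have "\<dots> \<le> 1 + (1 - 1 / 4)" by (simp add: power2_eq_square)
        also have "\<dots> \<le> 1 + exp (- l)" using exp_ge_add_one_self[of "- l"] small by simp
        also have "\<dots> = 1 + \<epsilon>" using \<epsilon> by (simp add: l_def ln_div)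
        finally show ?thesis by simp
      qed
      then have op: "op_norm (2 ^ n) (\<lambda>i j. mid i j - mexp (2 ^ n)
          (\<lambda>r c. - \<i> * complex_of_real t * ham_mat NL nq S coef r c) i j) \<le> \<epsilon>"
        using t by (intro simulation_trivial) auto
      have "0 \<le> C * p * lg * (x + l)" using C2 p lg0 x l by simp
      then show ?thesis
        using op block_encoding_identity[of n] \<epsilon> C2 lg0
        by (intro exI[of _ 0] exI[of _ "[]"] exI[of _ 1] exI[of _ mid])
          (simp add: p_def lg_def x_def l_def)
    next
      case False
      then have T: "T \<noteq> {}" and big: "1 \<le> 4 * D * (x + l)" by auto
      have "1 \<le> card T" using T finite_T by (simp add: Suc_le_eq card_gt_0_iff)
      from exists_pow2_between[OF this] obtain a where
        a: "card T \<le> 2 ^ a" "2 ^ a \<le> 2 * card T" by blast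
      have p1: "p \<ge> 1" using NP_pos[OF T] by (simp add: p_def)
      \<comment> \<open>This lets lg absorb the additive constants in the bounds on a.\<close>
      have lg1: "lg \<ge> 1" using p1 by (simp add: lg_def le_log_iff)
      have a2: "(2::real) ^ a \<le> 2 * D * p"
      proof -
        have "(2::real) ^ a \<le> 2 * real (card T)"
          using a(2) by (metis of_nat_le_iff of_nat_mult of_nat_numeral of_nat_power)
        then show ?thesis using card by simp
      qed
      have "real a = log 2 (2 ^ a)" by simp
      also have "\<dots> \<le> log 2 (2 ^ (L + 1) * (p + 1))"
      proof (rule log_mono)
        have "2 * D * p \<le> 2 * D * (p + 1)" using D p by (intro mult_left_mono) auto
        then have "(2::real) ^ a \<le> 2 * D * (p + 1)" using a2 by linarith
        then show "(2::real) ^ a \<le> 2 ^ (L + 1) * (p + 1)" by (simp add: D_def)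
      qed auto
      also have "\<dots> = log 2 (2 ^ (L + 1)) + lg"
        unfolding lg_def using p by (intro log_mult_pos) auto
      also have "log 2 (2 ^ (L + 1)) = real (L + 1)" by (rule log_pow_cancel) auto
      finally have "real a \<le> (real L + 1) * 1 + lg" by simp
      also have "\<dots> \<le> (real L + 1) * lg + lg" using lg1 by (intro add_right_mono mult_left_mono) auto
      finally have a_le: "real a \<le> (real L + 2) * lg" by (simp add: algebra_simps)
      define \<tau> where "\<tau> = 2 ^ a * cP S coef * t"
      have "\<tau> \<le> 2 * D * p * (cP S coef * t)"
        unfolding \<tau>_def mult.assoc[of "2 ^ a"] using a2 t cP_nonneg by (intro mult_right_mono) auto
      then have \<tau>: "\<tau> \<le> 2 * D * x" by (simp add: x_def mult_ac)
      have \<tau>0: "0 \<le> \<tau>" using t cP_nonneg by (simp add: \<tau>_def)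
      define K where "K = nat \<lceil>exp 1 * \<tau> + l\<rceil>"
      have pos: "exp 1 * \<tau> + l > 0" using \<tau>0 l by (simp add: add_nonneg_pos)
      have K: "1 \<le> K" "exp 1 * \<tau> + l \<le> real K" "real K \<le> exp 1 * \<tau> + l + 1"
        using pos by (simp_all add: K_def) linarith+
      have "exp 1 * \<tau> \<le> 3 * (2 * D * x)"
        using \<tau> \<tau>0 exp_le by (intro mult_mono) auto
      moreover have "l \<le> D * l" using D l by simp
      \<comment> \<open>The first summand used e <= 3; the 1 from rounding up is replaced by 4 D (x
        + l), which is at least 1 in this case.\<close>
      ultimately have "real K \<le> 6 * (D * x) + D * l + 4 * D * (x + l)"
        using K(3) big by simp
      also have "\<dots> \<le> 16 * D * (x + l)" using D x l by (simp add: algebra_simps)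
      finally have K16: "real K \<le> 16 * D * (x + l)" .
      from simulation[OF t \<epsilon>(1) T a(1) K(1)] K(2) obtain circ A where circ:
        "\<forall>g\<in>set circ. gate_ok (n + (a + 2)) g"
        "block_encoding n (a + 2) (circuit_mat (n + (a + 2)) circ) (1 + 2 * \<epsilon>) A"
        "op_norm (2 ^ n) (\<lambda>i j. A i j - mexp (2 ^ n)
          (\<lambda>r c. - \<i> * complex_of_real t * ham_mat NL nq S coef r c) i j) \<le> \<epsilon>"
        "circuit_cost circ \<le> 50 * K * (2 ^ a * (a + 1))"
        unfolding \<tau>_def l_def by blast
      have alpha: "\<bar>1 + 2 * \<epsilon> - 1\<bar> \<le> C * \<epsilon>" using C2 \<epsilon> by simp
      have "real (a + 2) \<le> (real L + 2) * lg + 2 * lg" using a_le lg1 by simp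
      also have "\<dots> = (real L + 4) * lg" by (simp add: algebra_simps)
      finally have a4: "real (a + 2) \<le> (real L + 4) * lg" .
      also have "\<dots> \<le> C * lg" using CL lg0 by (rule mult_right_mono)
      finally have anc: "real (a + 2) \<le> C * log 2 (real (NP S coef) + 1)" by (simp add: lg_def p_def)
      have "real (circuit_cost circ) \<le> 50 * real K * (2 ^ a * real (a + 1))"
        using circ(4) by (metis (no_types, lifting) of_nat_le_iff of_nat_mult of_nat_numeral of_nat_power)
      also have "\<dots> \<le> 50 * (16 * D * (x + l)) * ((2 * D * p) * ((real L + 4) * lg))"
        using K16 a2 a4 D p x l by (intro mult_mono) auto
      also have "\<dots> = C * p * lg * (x + l)"
        by (simp add: C_def power2_eq_square)
      finally have cost: "real (circuit_cost circ) \<le> C * real (NP S coef) * log 2 (real (NP S coef) + 1) *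
             (real (NP S coef) * cP S coef * t + ln (1 / \<epsilon>))"
        by (simp add: p_def lg_def x_def l_def)
      show ?thesis
        by (intro exI conjI) (rule circ(1) circ(2) alpha anc circ(3) cost)+
    qed
  qed
qed

end
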